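(* Let $\epsilon\in(0,1)$ and consider the tandem of independent binary erasure channels all with erasure probability $\epsilon$, with global state information (GSI) available at all nodes. Let $\{\xi_k\}_{k\ge1}\subset(0,1)$ be any sequence with $\xi_k\to0$ and $\lim_{k\to\infty}\frac1k\log(1/\xi_k)=0$. (i) For every $m\in\mathbb N$ (with $m\ge1$) and every $\rho\in(0,1)$, $$v^{\mathrm{GSI}}_{m}(\epsilon,\{\xi_i\})=v^{\mathrm{GSI}}_{\rho\text{-poly}}(\epsilon,\{\xi_i\})=1-\epsilon .$$ (ii) For every $\alpha>0$, $$v^{\mathrm{GSI}}_{\alpha\text{-linear}}(\epsilon,\{\xi_i\})\ \ge\ \frac{1-\epsilon}{1+2\sqrt{\alpha\epsilon}+\alpha}.$$
   Context: Network. For $k\ge1$ the tandem has nodes $0,1,\dots,k$. For $i=0,\dots,k-1$, node $i$ is connected to node $i+1$ by a binary erasure channel with erasure probability $\epsilon$: at each time $n=1,2,\dots$ node $i$ sends $X_i[n]\in\{0,1\}$ and node $i+1$ observes $Y_i[n]=X_i[n]$ if $S_i[n]=1$ and $Y_i[n]=\ast$ (erasure) if $S_i[n]=0$. The channel states $S_i[n]=\mathbf 1\{Y_i[n]\neq\ast\}$ are independent over all $i,n$, independent of the message, with $\Pr\{S_i[n]=1\}=1-\epsilon$. The message $M$ is uniform on $\{0,1,\dots,2^m-1\}$ ($m$ bits, $m\ge1$). Global state information (GSI): with $\mathbf S[n]=(S_0[n],\dots,S_{k-1}[n])$, $X_0[n]$ is a function of $(M,\mathbf S[1],\dots,\mathbf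 S[n-1])$, and for $i\ge1$, $X_i[n]$ is a function of $(Y_{i-1}[1],\dots,Y_{i-1}[n-1],\mathbf S[1],\dots,\mathbf S[n-1])$. After $t$ time instances node $k$ outputs an estimate $\hat M_{k,t}$, a function of its available information $(Y_{k-1}[1],\dots,Y_{k-1}[t],\mathbf S[1],\dots,\mathbf S[t])$. Minimum delay: $t^*_{m,k}(\epsilon,\xi)$ is the infimum of those $t$ for which there exist encoding functions (at nodes $0,\dots,k-1$) and a decoding function (at node $k$) such that $\Pr\{\hat M_{k,t}\ne M\}<\xi$. Information velocity: $v^{\mathrm{GSI}}_\triangle(\epsilon,\{\xi_i\})=\liminf_{k\to\infty}\dfrac{k}{t^*_{m,k}(\epsilon,\xi_k)}$, where $\triangle$ specifies how the message size depends on $k$: $\triangle=m$: the fixed constant $m$; $\triangle=\rho\text{-poly}$: $m=m_k=\Theta(k^\rho)$; $\triangle=\alpha\text{-linear}$: $m=m_k=\alpha k+o(k)$ (the statements are for any such sequence of positive integers). *)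

theory Defs
  imports "HOL-Probability.Probability" "HOL-Library.Landau_Symbols"
begin

text \<open>
  A realisation of the channel states: \<open>s (i, n)\<close> says that the symbol sent by node \<open>i\<close> at
  time \<open>n\<close> (times start at 1) is not erased. An erasure is received as \<open>None\<close>.
\<close>

type_synonym channel_states = "nat \<times> nat \<Rightarrow> bool"

text \<open>
  Coding functions take the observed past as lists in temporal order. Every history of the
  first \<open>n\<close> time instances has length \<open>n\<close>, so they may depend on the current time without taking
  it as a further argument. The first argument of a relay encoder is the index of the node.
\<close>

type_synonym state_history = "bool list list"
type_synonym source_encoder = "nat \<Rightarrow> state_history \<Rightarrow> bool"
type_synonym relay_encoder = "nat \<Rightarrow> bool option list \<Rightarrow> state_history \<Rightarrow> bool"
type_synonym decoder = "bool option list \<Rightarrow> state_history \<Rightarrow> nat"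

definition global_state :: "nat \<Rightarrow> channel_states \<Rightarrow> nat \<Rightarrow> bool list" where
  "global_state k s n = map (\<lambda>i. s (i, n)) [0..<k]"

definition state_history :: "nat \<Rightarrow> channel_states \<Rightarrow> nat \<Rightarrow> state_history" where
  "state_history k s n = map (global_state k s) [1..<Suc n]"

definition erasure_output :: "bool \<Rightarrow> bool \<Rightarrow> bool option" where
  "erasure_output unerased x = (if unerased then Some x else None)"

text \<open>\<open>channel_input k f g w s i n\<close> is \<open>X\<^sub>i[n]\<close> and \<open>channel_output k f g w s i n\<close> is \<open>Y\<^sub>i[n]\<close>.\<close>

primrec channel_input ::
  "nat \<Rightarrow> source_encoder \<Rightarrow> relay_encoder \<Rightarrow> nat \<Rightarrow> channel_states \<Rightarrow> nat \<Rightarrow> nat \<Rightarrow> bool" where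
  "channel_input k f g w s 0 = (\<lambda>n. f w (state_history k s (n - 1)))"
| "channel_input k f g w s (Suc i) =
     (\<lambda>n. g (Suc i)
            (map (\<lambda>l. erasure_output (s (i, l)) (channel_input k f g w s i l)) [1..<n])
            (state_history k s (n - 1)))"

definition channel_output ::
  "nat \<Rightarrow> source_encoder \<Rightarrow> relay_encoder \<Rightarrow> nat \<Rightarrow> channel_states \<Rightarrow> nat \<Rightarrow> nat \<Rightarrow> bool option"
  where "channel_output k f g w s i n = erasure_output (s (i, n)) (channel_input k f g w s i n)"

definition message_estimate ::
  "nat \<Rightarrow> nat \<Rightarrow> source_encoder \<Rightarrow> relay_encoder \<Rightarrow> decoder \<Rightarrow> nat \<Rightarrow> channel_states \<Rightarrow> nat" where
  "message_estimate k t f g d w s =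
     d (map (channel_output k f g w s (k - 1)) [1..<Suc t]) (state_history k s t)"

text \<open>
  Joint law of the message and of the channel states up to time \<open>t\<close>, which are the only ones
  the estimate at time \<open>t\<close> depends on.
\<close>

definition tandem_pmf :: "real \<Rightarrow> nat \<Rightarrow> nat \<Rightarrow> nat \<Rightarrow> (nat \<times> channel_states) pmf" where
  "tandem_pmf \<epsilon> m k t =
     pair_pmf (pmf_of_set {0..<2 ^ m})
       (Pi_pmf ({0..<k} \<times> {1..t}) False (\<lambda>_. bernoulli_pmf (1 - \<epsilon>)))"

definition error_probability ::
  "real \<Rightarrow> nat \<Rightarrow> nat \<Rightarrow> nat \<Rightarrow> source_encoder \<Rightarrow> relay_encoder \<Rightarrow> decoder \<Rightarrow> real" where
  "error_probability \<epsilon> m k t f g d =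
     measure_pmf.prob (tandem_pmf \<epsilon> m k t) {(w, s). message_estimate k t f g d w s \<noteq> w}"

text \<open>The infimum is taken in \<^typ>\<open>enat\<close>, so that it is infinite if no delay is achievable.\<close>

definition minimum_delay :: "nat \<Rightarrow> nat \<Rightarrow> real \<Rightarrow> real \<Rightarrow> enat" where
  "minimum_delay m k \<epsilon> \<xi> = Inf {enat t |t. \<exists>f g d. error_probability \<epsilon> m k t f g d < \<xi>}"

definition information_velocity :: "real \<Rightarrow> (nat \<Rightarrow> nat) \<Rightarrow> (nat \<Rightarrow> real) \<Rightarrow> ereal" where
  "information_velocity \<epsilon> m \<xi> =
     liminf (\<lambda>k. ereal (real k) / ereal_of_enat (minimum_delay (m k) k \<epsilon> (\<xi> k)))"

definition poly_message_size :: "real \<Rightarrow> (nat \<Rightarrow> nat) \<Rightarrow> bool" where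
  "poly_message_size \<rho> m \<longleftrightarrow>
     (\<forall>k\<ge>1. m k \<ge> 1) \<and> (\<lambda>k. real (m k)) \<in> \<Theta>(\<lambda>k. real k powr \<rho>)"

definition linear_message_size :: "real \<Rightarrow> (nat \<Rightarrow> nat) \<Rightarrow> bool" where
  "linear_message_size \<alpha> m \<longleftrightarrow>
     (\<forall>k\<ge>1. m k \<ge> 1) \<and> (\<lambda>k. real (m k) - \<alpha> * real k) \<in> o(\<lambda>k. real k)"

end

(*
With global state information every node knows how many packets (bits) have crossed each channel,
so the nodes can forward the message bits in order, as customers of a tandem of queues with
geometric service times. Compare this tandem, started with m packets at node 0, with a stationary
one: Bernoulli(l) arrivals with l < p = 1 - eps, and independent queue lengths with the stationary
law. By a discrete form of Burke's theorem the stationary tandem has Bernoulli(l) departures. If it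
has had at least m departures on top of the packets it contained initially, then the original
tandem is done. Both the number of departures by time t (mean l t) and the initial content (mean
k l (1 - l) / (p - l)) have exponentially small deviation probabilities, which are beaten by the
subexponential threshold xi; so any t > m / l + k (1 - l) / (p - l) works asymptotically. For
m = alpha k the best choice is l = p sqrt alpha / (sqrt alpha + sqrt eps). Letting alpha tend to 0
gives the velocity 1 - eps for sublinear messages.

Conversely, information advances at most one node per time step, and only over an unerased channel.
The front therefore moves with probability at most p per step, and the decoder can do no better
than guess before the front has reached node k.
*)
theory Submission
  imports Defs "HOL-Real_Asymp.Real_Asymp"
begin

section \<open>Independent samples\<close>

lemma map_replicate_pmf: "map_pmf (map f) (replicate_pmf n P) = replicate_pmf n (map_pmf f P)"
proof (induction n)
  case (Suc n)
  show ?case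
    by (simp add: map_bind_pmf bind_map_pmf flip: Suc.IH)
qed simp

lemma map_nth_replicate_pmf:
  "i < n \<Longrightarrow> map_pmf (\<lambda>xs. xs ! i) (replicate_pmf n P) = P"
proof (induction n arbitrary: i)
  case (Suc n)
  then show ?case
    by (cases i) (simp_all add: map_bind_pmf bind_return_pmf', simp add: map_pmf_def)
qed simp

lemma map_Pi_pmf_eq_replicate_pmf:
  "distinct xs \<Longrightarrow>
   map_pmf (\<lambda>s. map s xs) (Pi_pmf (set xs) d (\<lambda>_. P)) = replicate_pmf (length xs) P"
proof (induction xs)
  case (Cons x xs)
  have *: "map (s(x := y)) xs = map s xs" for s y
    using Cons.prems by (auto intro!: map_cong)
  have "map_pmf (\<lambda>s. map s (x # xs)) (Pi_pmf (set (x # xs)) d (\<lambda>_. P)) =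
      P \<bind> (\<lambda>y. map_pmf (\<lambda>s. y # map s xs) (Pi_pmf (set xs) d (\<lambda>_. P)))"
    using Cons.prems
    by (simp add: Pi_pmf_insert' map_bind_pmf *) (simp add: map_pmf_def)
  also have "\<dots> = P \<bind> (\<lambda>y. map_pmf (Cons y) (map_pmf (\<lambda>s. map s xs) (Pi_pmf (set xs) d (\<lambda>_. P))))"
    by (simp add: pmf.map_comp o_def)
  finally show ?case
    using Cons by (simp add: map_pmf_def)
qed simp

text \<open>The columns of the grid are disjoint blocks of indices and hence independent; the
  induction splits off one column at a time.\<close>

lemma map_Pi_pmf_grid_eq_replicate_pmf:
  assumes "distinct xs"
  shows "distinct ns \<Longrightarrow>
    map_pmf (\<lambda>s. map (\<lambda>n. map (\<lambda>i. s (i, n)) xs) ns) (Pi_pmf (set xs \<times> set ns) d (\<lambda>_. P)) =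
      replicate_pmf (length ns) (replicate_pmf (length xs) P)"
proof (induction ns)
  case (Cons n ns)
  let ?A = "set xs \<times> {n}" and ?B = "set xs \<times> set ns"
  let ?col = "\<lambda>n s. map (\<lambda>i. s (i, n)) xs"
  have eq: "set xs \<times> set (n # ns) = ?A \<union> ?B" by auto
  have col: "map_pmf (?col n) (Pi_pmf ?A d (\<lambda>_. P)) = replicate_pmf (length xs) P"
  proof -
    have "?A = set (map (\<lambda>i. (i, n)) xs)" by auto
    moreover have "distinct (map (\<lambda>i. (i, n)) xs)"
      using assms by (simp add: distinct_map inj_on_def)
    ultimately show ?thesis
      using map_Pi_pmf_eq_replicate_pmf[of "map (\<lambda>i. (i, n)) xs" d P] by (simp add: o_def)
  qed
  have dis: "?A \<inter> ?B = {}" using Cons.prems by auto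
  have "map_pmf (\<lambda>s. map (\<lambda>n. ?col n s) (n # ns)) (Pi_pmf (set xs \<times> set (n # ns)) d (\<lambda>_. P)) =
      map_pmf (\<lambda>(f, g). ?col n f # map (\<lambda>n. ?col n g) ns)
        (pair_pmf (Pi_pmf ?A d (\<lambda>_. P)) (Pi_pmf ?B d (\<lambda>_. P)))"
    unfolding eq using Cons.prems
    by (subst Pi_pmf_union[OF _ _ dis])
       (auto simp: pmf.map_comp o_def case_prod_unfold intro!: map_pmf_cong)
  also have "\<dots> = map_pmf (\<lambda>(c, h). c # h) (map_pmf (\<lambda>(f, g). (?col n f, map (\<lambda>n. ?col n g) ns))
        (pair_pmf (Pi_pmf ?A d (\<lambda>_. P)) (Pi_pmf ?B d (\<lambda>_. P))))"
    by (simp add: pmf.map_comp o_def case_prod_unfold)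
  also have "\<dots> = map_pmf (\<lambda>(c, h). c # h)
      (pair_pmf (replicate_pmf (length xs) P) (replicate_pmf (length ns) (replicate_pmf (length xs) P)))"
    unfolding map_pair col using Cons by simp
  finally show ?case
    by (simp add: pair_pmf_def map_bind_pmf)
qed simp

text \<open>Turns the states on the grid into a list of independent columns, so that probabilities
  can be bounded by induction over time.\<close>

lemma map_state_history_Pi_pmf:
  "map_pmf (\<lambda>s. state_history k s t) (Pi_pmf ({0..<k} \<times> {1..t}) False (\<lambda>_. P)) =
    replicate_pmf t (replicate_pmf k P)"
proof -
  have *: "set [0..<k] \<times> set [1..<Suc t] = {0..<k} \<times> {1..t}" by auto
  show ?thesis
    using map_Pi_pmf_grid_eq_replicate_pmf[of "[0..<k]" "[1..<Suc t]" False P]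
    unfolding * state_history_def global_state_def by (simp del: upt_Suc)
qed

text \<open>Markov's inequality for the exponential of the sum, whose expectation factorises by
  independence. Tilt and threshold are absorbed into \<open>g\<close>, so one form serves upper and
  lower tails.\<close>

lemma chernoff_replicate_pmf:
  fixes g :: "'a \<Rightarrow> real" and P :: "'a pmf"
  assumes "(\<integral>\<^sup>+x. ennreal (exp (g x)) \<partial>P) \<le> ennreal r" and "r \<ge> 0"
  shows "measure_pmf.prob (replicate_pmf n P) {xs. sum_list (map g xs) \<ge> 0} \<le> r ^ n"
proof -
  let ?E = "\<lambda>xs. ennreal (exp (sum_list (map g xs)))"
  have int: "(\<integral>\<^sup>+xs. ?E xs \<partial>replicate_pmf n P) \<le> ennreal r ^ n"
  proof (induction n)
    case (Suc n)
    have "(\<integral>\<^sup>+xs. ?E xs \<partial>replicate_pmf (Suc n) P) =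
      (\<integral>\<^sup>+x. ennreal (exp (g x)) * (\<integral>\<^sup>+xs. ?E xs \<partial>replicate_pmf n P) \<partial>P)"
      by (simp add: exp_add ennreal_mult nn_integral_cmult)
    also have "\<dots> = (\<integral>\<^sup>+x. ennreal (exp (g x)) \<partial>P) * (\<integral>\<^sup>+xs. ?E xs \<partial>replicate_pmf n P)"
      by (simp add: nn_integral_multc)
    also have "\<dots> \<le> ennreal r * ennreal r ^ n"
      by (intro mult_mono Suc.IH assms(1)) auto
    finally show ?case by simp
  qed simp
  have "emeasure (replicate_pmf n P) {xs. sum_list (map g xs) \<ge> 0} \<le> (\<integral>\<^sup>+xs. ?E xs \<partial>replicate_pmf n P)"
    using nn_integral_Markov_inequality[of ?E UNIV "measure_pmf (replicate_pmf n P)" 1] by simp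
  also note int
  finally have "ennreal (measure_pmf.prob (replicate_pmf n P) {xs. sum_list (map g xs) \<ge> 0}) \<le> ennreal (r ^ n)"
    using assms(2) by (simp add: measure_pmf.emeasure_eq_measure ennreal_power)
  then show ?thesis
    using assms(2) by (subst (asm) ennreal_le_iff) auto
qed

section \<open>Stationary queues\<close>

text \<open>The stationary law for Bernoulli(\<open>l\<close>) arrivals and
  Bernoulli(\<open>p\<close>) services: positive with probability \<open>l / p\<close>, and then
  geometric on 1, 2, ... with ratio \<open>l * (1 - p) / (p * (1 - l))\<close>.\<close>

definition queue_pmf :: "real \<Rightarrow> real \<Rightarrow> nat pmf" where
  "queue_pmf p l = bernoulli_pmf (l / p) \<bind> (\<lambda>b. if b
     then map_pmf Suc (geometric_pmf ((p - l) / (p * (1 - l)))) else return_pmf 0)"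

text \<open>Service precedes admission: a packet cannot be served in the step in which it arrives,
  just as a relay cannot forward a symbol at the time of its reception.\<close>

definition queue_step :: "bool \<Rightarrow> bool \<Rightarrow> nat \<Rightarrow> bool \<times> nat" where
  "queue_step a s q = (s \<and> q > 0, q - of_bool (s \<and> q > 0) + of_bool a)"

lemma queue_param:
  fixes p l :: real
  assumes "0 < l" "l < p" "p < 1"
  shows "0 < (p - l) / (p * (1 - l))" "(p - l) / (p * (1 - l)) < 1"
    "1 - (p - l) / (p * (1 - l)) = l * (1 - p) / (p * (1 - l))"
  using assms by (auto simp: divide_simps) (auto simp: algebra_simps)

lemma pmf_queue:
  assumes "0 < l" "l < p" "p < 1"
  shows "pmf (queue_pmf p l) 0 = 1 - l / p"
    and "pmf (queue_pmf p l) (Suc n) =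
      l / p * ((l * (1 - p) / (p * (1 - l))) ^ n * ((p - l) / (p * (1 - l))))"
proof -
  have *: "0 \<le> l / p" "l / p \<le> 1" using assms by auto
  have S: "Suc -` {Suc n} = {n}" "Suc -` {0} = {}" for n by auto
  show "pmf (queue_pmf p l) 0 = 1 - l / p"
    using * assms by (simp add: queue_pmf_def pmf_bind pmf_map S)
  show "pmf (queue_pmf p l) (Suc n) =
      l / p * ((l * (1 - p) / (p * (1 - l))) ^ n * ((p - l) / (p * (1 - l))))"
    using * queue_param[OF assms]
    by (simp add: queue_pmf_def pmf_bind pmf_map measure_pmf_single S del: times_divide_eq_right times_divide_eq_left)
qed

text \<open>Once \<open>a\<close> and the service are fixed, \<open>queue_step\<close> is injective
  in the length, so each mass is a single value of \<open>pmf P\<close> or 0.\<close>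

lemma pmf_map_queue_step:
  "pmf (map_pmf (queue_step a False) P) (d, q) =
     (if d then 0 else if a then (if q = 0 then 0 else pmf P (q - 1)) else pmf P q)"
  "pmf (map_pmf (queue_step a True) P) (d, q) =
     (if d then (if a then (if q = 0 then 0 else pmf P q) else pmf P (Suc q))
      else if q = of_bool a then pmf P 0 else 0)"
proof -
  have v: "queue_step a False -` {(d, q)} =
     (if d then {} else if a then (if q = 0 then {} else {q - 1}) else {q})"
    by (auto simp: queue_step_def)
  show "pmf (map_pmf (queue_step a False) P) (d, q) =
     (if d then 0 else if a then (if q = 0 then 0 else pmf P (q - 1)) else pmf P q)"
    unfolding pmf_map v by (simp add: measure_pmf_single)
  have v: "queue_step a True -` {(d, q)} =
     (if d then (if a then (if q = 0 then {} else {q}) else {Suc q})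
      else if q = of_bool a then {0} else {})"
    by (auto simp: queue_step_def)
  show "pmf (map_pmf (queue_step a True) P) (d, q) =
     (if d then (if a then (if q = 0 then 0 else pmf P q) else pmf P (Suc q))
      else if q = of_bool a then pmf P 0 else 0)"
    unfolding pmf_map v by (simp add: measure_pmf_single)
qed

text \<open>One step of Burke's theorem: the departure is again Bernoulli(\<open>l\<close>) and
  independent of the length left behind, which keeps its law. Pointwise this reduces to detailed
  balance.\<close>

lemma queue_burke:
  assumes "0 < l" "l < p" "p < 1"
  shows "bernoulli_pmf l \<bind> (\<lambda>a. bernoulli_pmf p \<bind> (\<lambda>s. map_pmf (queue_step a s) (queue_pmf p l)))
     = pair_pmf (bernoulli_pmf l) (queue_pmf p l)"
proof (rule pmf_eqI, clarify)
  fix d q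
  let ?Q = "pmf (queue_pmf p l)"
  have ne: "0 \<le> p" "p \<le> 1" "0 \<le> l" "l \<le> 1" "p * (1 - l) \<noteq> 0" using assms by auto
  \<comment> \<open>Detailed balance: going up takes an arrival without service, going down a
    service without arrival. An empty queue goes up with any arrival, hence no factor
    \<open>1 - p\<close> in \<open>Q1\<close>.\<close>
  have Q1: "p * (1 - l) * ?Q (Suc 0) = l * ?Q 0"
    using assms by (simp add: pmf_queue divide_simps)
  have QS: "p * (1 - l) * ?Q (Suc (Suc n)) = l * (1 - p) * ?Q (Suc n)" for n
    using assms by (simp add: pmf_queue)
  show "pmf (bernoulli_pmf l \<bind> (\<lambda>a. bernoulli_pmf p \<bind> (\<lambda>s. map_pmf (queue_step a s) (queue_pmf p l)))) (d, q)
     = pmf (pair_pmf (bernoulli_pmf l) (queue_pmf p l)) (d, q)"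
  proof (cases q)
    case 0
    then show ?thesis using ne Q1
      by (cases d) (simp_all add: pmf_bind pmf_map_queue_step pmf_pair, simp_all add: algebra_simps)
  next
    case (Suc n)
    then show ?thesis using ne Q1 QS[of n] QS[of "n - 1"]
      by (cases n; cases d) (simp_all add: pmf_bind pmf_map_queue_step pmf_pair, simp_all add: algebra_simps)
  qed
qed

text \<open>The departure \<open>d\<close> reaches the next queue in the same step but is not served
  there until a later one, so a packet crosses at most one channel per step.\<close>

primrec tandem_step :: "bool \<Rightarrow> nat list \<Rightarrow> bool list \<Rightarrow> bool \<times> nat list" where
  "tandem_step a [] ss = (a, [])"
| "tandem_step a (q # qs) ss =
     (let (d, q') = queue_step a (hd ss) q; (b, qs') = tandem_step d qs (tl ss) in (b, q' # qs'))"

primrec tandem_departures :: "nat list \<Rightarrow> (bool \<times> bool list) list \<Rightarrow> bool list" where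
  "tandem_departures qs [] = []"
| "tandem_departures qs (x # xs) =
     (let (b, qs') = tandem_step (fst x) qs (snd x) in b # tandem_departures qs' xs)"

text \<open>Induction along the tandem: by \<open>queue_burke\<close> the first queue hands the
  others Bernoulli(\<open>l\<close>) arrivals that are independent of its own new length.\<close>

lemma tandem_burke:
  assumes "0 < l" "l < p" "p < 1"
  shows "bernoulli_pmf l \<bind> (\<lambda>a. replicate_pmf k (bernoulli_pmf p) \<bind> (\<lambda>ss.
      map_pmf (\<lambda>qs. tandem_step a qs ss) (replicate_pmf k (queue_pmf p l)))) =
    pair_pmf (bernoulli_pmf l) (replicate_pmf k (queue_pmf p l))"
proof (induction k)
  case 0
  show ?case
    by (simp add: bind_return_pmf pair_return_pmf2 map_pmf_def)
next
  case (Suc k)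
  let ?A = "bernoulli_pmf l" and ?S = "bernoulli_pmf p" and ?Q = "queue_pmf p l"
  let ?Ss = "replicate_pmf k ?S" and ?Qs = "replicate_pmf k ?Q"
  let ?T = "\<lambda>d ss qs. return_pmf (tandem_step d qs ss)"
  have "?A \<bind> (\<lambda>a. replicate_pmf (Suc k) ?S \<bind> (\<lambda>ss.
      map_pmf (\<lambda>qs. tandem_step a qs ss) (replicate_pmf (Suc k) ?Q))) =
    ?A \<bind> (\<lambda>a. ?S \<bind> (\<lambda>s. ?Ss \<bind> (\<lambda>ss. ?Q \<bind> (\<lambda>q. ?Qs \<bind> (\<lambda>qs.
      map_pmf (\<lambda>(b, qs'). (b, snd (queue_step a s q) # qs')) (?T (fst (queue_step a s q)) ss qs))))))"
    by (simp add: bind_assoc_pmf bind_return_pmf map_bind_pmf case_prod_unfold Let_def)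
  \<comment> \<open>Drawing \<open>q\<close> before the other services collects all the randomness
    of the first queue.\<close>
  also have "\<dots> = ?A \<bind> (\<lambda>a. ?S \<bind> (\<lambda>s. ?Q \<bind> (\<lambda>q. ?Ss \<bind> (\<lambda>ss. ?Qs \<bind> (\<lambda>qs.
      map_pmf (\<lambda>(b, qs'). (b, snd (queue_step a s q) # qs')) (?T (fst (queue_step a s q)) ss qs))))))"
    by (subst (2) bind_commute_pmf) (rule refl)
  also have "\<dots> = (?A \<bind> (\<lambda>a. ?S \<bind> (\<lambda>s. map_pmf (queue_step a s) ?Q))) \<bind> (\<lambda>(d, q'). 
      map_pmf (\<lambda>(b, qs'). (b, q' # qs')) (?Ss \<bind> (\<lambda>ss. map_pmf (\<lambda>qs. tandem_step d qs ss) ?Qs)))"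
    by (simp add: bind_assoc_pmf bind_map_pmf map_bind_pmf case_prod_unfold)
       (simp add: map_pmf_def bind_assoc_pmf bind_return_pmf)
  also have "\<dots> = ?Q \<bind> (\<lambda>q'. map_pmf (\<lambda>(b, qs'). (b, q' # qs'))
      (?A \<bind> (\<lambda>d. ?Ss \<bind> (\<lambda>ss. map_pmf (\<lambda>qs. tandem_step d qs ss) ?Qs))))"
    unfolding queue_burke[OF assms]
    by (simp add: pair_pmf_def bind_assoc_pmf bind_return_pmf map_bind_pmf)
       (rule bind_commute_pmf)
  also have "\<dots> = pair_pmf ?A (replicate_pmf (Suc k) ?Q)"
    unfolding Suc.IH
    by (simp add: pair_pmf_def map_bind_pmf bind_assoc_pmf bind_return_pmf)
       (rule bind_commute_pmf)
  finally show ?case .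
qed

text \<open>Each departure is independent of the lengths it leaves behind, which are stationary
  again; so the induction over time restarts from the same law.\<close>

lemma tandem_departures_burke:
  assumes "0 < l" "l < p" "p < 1"
  shows "map_pmf (\<lambda>(qs, xs). tandem_departures qs xs)
     (pair_pmf (replicate_pmf k (queue_pmf p l))
       (replicate_pmf t (pair_pmf (bernoulli_pmf l) (replicate_pmf k (bernoulli_pmf p))))) =
     replicate_pmf t (bernoulli_pmf l)"
proof (induction t)
  case 0
  show ?case by (simp add: pair_return_pmf2 pmf.map_comp o_def)
next
  case (Suc t)
  let ?A = "bernoulli_pmf l" and ?Ss = "replicate_pmf k (bernoulli_pmf p)" 
  let ?Qs = "replicate_pmf k (queue_pmf p l)"
  let ?X = "replicate_pmf t (pair_pmf ?A ?Ss)"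
  have "map_pmf (\<lambda>(qs, xs). tandem_departures qs xs)
     (pair_pmf ?Qs (replicate_pmf (Suc t) (pair_pmf ?A ?Ss))) =
     ?Qs \<bind> (\<lambda>qs. ?A \<bind> (\<lambda>a. ?Ss \<bind> (\<lambda>ss. ?X \<bind> (\<lambda>xs.
       return_pmf (fst (tandem_step a qs ss) # tandem_departures (snd (tandem_step a qs ss)) xs)))))"
    by (simp add: pair_pmf_def map_bind_pmf bind_assoc_pmf bind_return_pmf case_prod_unfold Let_def)
  also have "\<dots> = ?A \<bind> (\<lambda>a. ?Ss \<bind> (\<lambda>ss. ?Qs \<bind> (\<lambda>qs. ?X \<bind> (\<lambda>xs.
       return_pmf (fst (tandem_step a qs ss) # tandem_departures (snd (tandem_step a qs ss)) xs)))))"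
    by (subst bind_commute_pmf, subst (2) bind_commute_pmf) (rule refl)
  also have "\<dots> = (?A \<bind> (\<lambda>a. ?Ss \<bind> (\<lambda>ss. map_pmf (\<lambda>qs. tandem_step a qs ss) ?Qs))) \<bind>
       (\<lambda>(d, qs'). ?X \<bind> (\<lambda>xs. return_pmf (d # tandem_departures qs' xs)))"
    by (simp add: bind_assoc_pmf bind_map_pmf case_prod_unfold)
  also have "\<dots> = ?A \<bind> (\<lambda>d. map_pmf (Cons d) (map_pmf (\<lambda>(qs, xs). tandem_departures qs xs) (pair_pmf ?Qs ?X)))"
    unfolding tandem_burke[OF assms]
    by (simp add: pair_pmf_def map_bind_pmf bind_assoc_pmf bind_return_pmf)
  also have "\<dots> = replicate_pmf (Suc t) ?A"
    unfolding Suc.IH by (simp add: map_pmf_def)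
  finally show ?case .
qed

section \<open>The packet-forwarding code\<close>

text \<open>\<open>C i\<close> counts the packets that have crossed channel \<open>i\<close>; node 0 starts with all \<open>m\<close> of them.\<close>

definition upstream :: "nat \<Rightarrow> (nat \<Rightarrow> nat) \<Rightarrow> nat \<Rightarrow> nat" where
  "upstream m C i = (case i of 0 \<Rightarrow> m | Suc j \<Rightarrow> C j)"

text \<open>All channels are updated from the old counts, so a packet just received is forwarded in
  a later step only.\<close>

definition count_step :: "nat \<Rightarrow> (nat \<Rightarrow> nat) \<Rightarrow> bool list \<Rightarrow> nat \<Rightarrow> nat" where
  "count_step m C c i = C i + of_bool (c ! i \<and> C i < upstream m C i)"

definition crossed :: "nat \<Rightarrow> state_history \<Rightarrow> nat \<Rightarrow> nat" where
  "crossed m h = foldl (count_step m) (\<lambda>_. 0) h"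

text \<open>Conservation of packets: the first \<open>Suc i\<close> queues gain the arrival
  \<open>a\<close> and lose only what queue \<open>i\<close> serves.\<close>

lemma tandem_step_prefix:
  assumes "length qs = length ss" "i < length qs"
  shows "sum_list (take (Suc i) (snd (tandem_step a qs ss))) + of_bool (ss ! i \<and> qs ! i > 0) =
    sum_list (take (Suc i) qs) + of_bool a"
  using assms
proof (induction qs arbitrary: a i ss)
  case (Cons q qs)
  obtain s ss' where ss: "ss = s # ss'" using Cons.prems by (cases ss) auto
  define d where "d = fst (queue_step a s q)"
  have q: "snd (queue_step a s q) + of_bool d = q + of_bool a"
    by (auto simp: queue_step_def d_def)
  show ?case
  proof (cases i)
    case 0
    then show ?thesis
      using q by (simp add: ss case_prod_unfold Let_def d_def) (simp add: queue_step_def)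
  next
    case (Suc j)
    then show ?thesis
      using q Cons.IH[of ss' j d] Cons.prems by (simp add: ss case_prod_unfold Let_def d_def)
  qed
qed simp

lemma length_tandem_step: "length (snd (tandem_step a qs ss)) = length qs"
  by (induction qs arbitrary: a ss) (simp_all add: case_prod_unfold Let_def)

lemma tandem_step_balance:
  "of_bool (fst (tandem_step a qs ss)) + sum_list (snd (tandem_step a qs ss)) = sum_list qs + of_bool a"
proof (induction qs arbitrary: a ss)
  case (Cons q qs)
  have "snd (queue_step a (hd ss) q) + of_bool (fst (queue_step a (hd ss) q)) = q + of_bool a"
    by (auto simp: queue_step_def)
  with Cons.IH[of "fst (queue_step a (hd ss) q)" "tl ss"] show ?case
    by (simp add: case_prod_unfold Let_def)
qed simp

text \<open>\<open>A - sum_list (take (Suc i) qs)\<close> is the number of the newly arrived packets that have crossed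
  channel \<open>i\<close>, where \<open>A\<close> packets have arrived: the packets initially present go first.\<close>

lemma crossed_ge_departures:
  assumes "length qs = k" "k > 0" "\<And>x. x \<in> set xs \<Longrightarrow> length (snd x) = k"
    and "\<And>i. i < k \<Longrightarrow> min (A - int (sum_list (take (Suc i) qs))) (int m) \<le> int (C i)"
    and "int m \<le> A + int (count_list (tandem_departures qs xs) True) - int (sum_list qs)"
  shows "m \<le> foldl (count_step m) C (map snd xs) (k - 1)"
  using assms
proof (induction xs arbitrary: A qs C)
  case Nil
  then show ?case using Nil(4)[of "k - 1"] by simp
next
  case (Cons x xs)
  obtain a ss where x: "x = (a, ss)" by force
  obtain b qs' where ts: "tandem_step a qs ss = (b, qs')" by force
  have len: "length ss = k" using Cons.prems(3)[of x] x by simp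
  have bal: "of_bool b + sum_list qs' = sum_list qs + of_bool a"
    using tandem_step_balance[of a qs ss] ts by simp
  have cnt: "count_list (tandem_departures qs (x # xs)) True = of_bool b + count_list (tandem_departures qs' xs) True"
    by (simp add: x ts)
  have "m \<le> foldl (count_step m) (count_step m C ss) (map snd xs) (k - 1)"
  proof (rule Cons.IH)
    show "length qs' = k" using length_tandem_step[of a qs ss] ts Cons.prems(1) by simp
    show "int m \<le> (A + of_bool a) + int (count_list (tandem_departures qs' xs) True) - int (sum_list qs')"
      using Cons.prems(5) bal cnt by (cases a; cases b) simp_all
    show "min (A + of_bool a - int (sum_list (take (Suc i) qs'))) (int m) \<le> int (count_step m C ss i)"
      if i: "i < k" for i
    proof -
      have p: "sum_list (take (Suc i) qs') + of_bool (ss ! i \<and> qs ! i > 0) =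
          sum_list (take (Suc i) qs) + of_bool a"
        using tandem_step_prefix[of qs ss i a] ts len i Cons.prems(1) by simp
      have s: "sum_list (take (Suc i) qs) = sum_list (take i qs) + qs ! i"
        using i Cons.prems(1) by (simp add: take_Suc_conv_app_nth)
      \<comment> \<open>For \<open>i = 0\<close> the upstream count is \<open>m\<close>, and the
        minimum makes the bound trivial; otherwise this is the invariant of channel
        \<open>i - 1\<close>.\<close>
      have u: "min (A - int (sum_list (take i qs))) (int m) \<le> int (upstream m C i)"
        using Cons.prems(4)[of "i - 1"] i by (cases i) (auto simp: upstream_def)
      have e: "A + of_bool a - int (sum_list (take (Suc i) qs')) =
          A - int (sum_list (take (Suc i) qs)) + of_bool (ss ! i \<and> qs ! i > 0)"
        using p by (cases a; cases "ss ! i \<and> qs ! i > 0") simp_all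
      note c = Cons.prems(4)[OF i]
      show ?thesis
      \<comment> \<open>The only critical case: the stationary queue serves while channel
        \<open>i\<close> has no packet left to send. Then \<open>C i\<close> has caught up with its
        upstream count, and \<open>qs ! i > 0\<close> keeps the new bound below the upstream
        one.\<close>
      proof (cases "ss ! i \<and> qs ! i > 0 \<and> \<not> C i < upstream m C i")
        case True
        then have "A + of_bool a - int (sum_list (take (Suc i) qs')) \<le> A - int (sum_list (take i qs))"
          unfolding e s by simp
        with u have "min (A + of_bool a - int (sum_list (take (Suc i) qs'))) (int m) \<le> int (upstream m C i)"
          by linarith
        with True show ?thesis by (simp only: count_step_def) simp
      next
        case False
        then have "of_bool (ss ! i \<and> qs ! i > 0) \<le> (of_bool (ss ! i \<and> C i < upstream m C i) :: int)"
          by auto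
        with c show ?thesis unfolding e count_step_def by simp linarith
      qed
    qed
  qed (use Cons.prems in auto)
  then show ?case by (simp add: x)
qed

section \<open>Correctness of the packet-forwarding code\<close>

lemma length_state_history [simp]: "length (state_history k s n) = n"
  by (simp add: state_history_def)

lemma state_history_0 [simp]: "state_history k s 0 = []"
  by (simp add: state_history_def)

lemma state_history_Suc:
  "state_history k s (Suc n) = state_history k s n @ [global_state k s (Suc n)]"
  by (simp add: state_history_def)

lemma channel_input_Suc:
  "channel_input k f g w s (Suc i) (Suc n) =
     g (Suc i) (map (channel_output k f g w s i) [1..<Suc n]) (state_history k s n)"
  by (simp add: channel_output_def[abs_def] del: upt_Suc)

lemma crossed_Nil [simp]: "crossed m [] i = 0"
  by (simp add: crossed_def)

lemma crossed_snoc: "crossed m (h @ [c]) i = count_step m (crossed m h) c i"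
  by (simp add: crossed_def)

lemma crossed_le: "crossed m h i \<le> m"
proof (induction h arbitrary: i rule: rev_induct)
  case (snoc c h)
  have "upstream m (crossed m h) i \<le> m"
    using snoc.IH by (cases i) (auto simp: upstream_def)
  with snoc.IH[of i] show ?case by (auto simp: crossed_snoc count_step_def)
qed simp

text \<open>The counts depend on the states alone, so every node knows which symbols carry a new
  packet and skips the rest. Position \<open>n\<close> stands for time \<open>n + 1\<close>. A count
  grows only over an unerased channel, so \<open>the\<close> meets no erasure in actual use.\<close>

definition received :: "nat \<Rightarrow> nat \<Rightarrow> bool option list \<Rightarrow> state_history \<Rightarrow> bool list" where
  "received m i ys h = map (\<lambda>n. the (ys ! n))
     (filter (\<lambda>n. crossed m (take n h) i < crossed m (take (Suc n) h) i) [0..<length h])"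

definition source_code :: "nat \<Rightarrow> source_encoder" where
  "source_code m w h = bit w (crossed m h 0)"

text \<open>If every packet at hand has been forwarded, the index is out of range and the symbol
  unspecified; the count does not grow then, so the receiver skips it.\<close>

definition relay_code :: "nat \<Rightarrow> relay_encoder" where
  "relay_code m i ys h = received m (i - 1) ys h ! crossed m h i"

definition packet_decoder :: "nat \<Rightarrow> nat \<Rightarrow> decoder" where
  "packet_decoder m k ys h = horner_sum of_bool 2 (received m (k - 1) ys h)"

lemma received_snoc:
  assumes "length ys = length h"
  shows "received m i (ys @ [y]) (h @ [c]) =
    received m i ys h @ (if crossed m h i < crossed m (h @ [c]) i then [the y] else [])"
  using assms by (auto simp: received_def nth_append intro!: map_cong filter_cong)

text \<open>An outer induction along the tandem and an inner one over time: what a node has received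
  is always an initial segment of the message bits.\<close>

lemma received_packets:
  assumes "i < k"
  shows "received m i (map (channel_output k (source_code m) (relay_code m) w s i) [1..<Suc n])
      (state_history k s n) = map (bit w) [0..<crossed m (state_history k s n) i]"
  using assms
proof (induction i arbitrary: n)
  case (0 n)
  show ?case
  proof (induction n)
    case (Suc n)
    show ?case
      using Suc 0
      by (auto simp: state_history_Suc received_snoc crossed_snoc count_step_def
          channel_output_def erasure_output_def source_code_def global_state_def)
  qed (simp add: received_def)
next
  case (Suc i n)
  note packets_i = Suc.IH and i = Suc.prems
  show ?case
  proof (induction n)
    case (Suc n)
    let ?h = "state_history k s n"
    \<comment> \<open>The outer induction hypothesis replaces the content of the sending node by
      message bits.\<close>
    have out: "channel_output k (source_code m) (relay_code m) w s (Suc i) (Suc n) =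
      erasure_output (s (Suc i, Suc n)) (map (bit w) [0..<crossed m ?h i] ! crossed m ?h (Suc i))"
      unfolding channel_output_def[of _ _ _ _ _ "Suc i"] channel_input_Suc relay_code_def
        diff_Suc_1 packets_i[OF Suc_lessD[OF i]] ..
    show ?case
      using Suc.IH i
      by (auto simp: state_history_Suc received_snoc crossed_snoc count_step_def upstream_def
          out erasure_output_def global_state_def)
  qed (simp add: received_def)
qed

lemma message_estimate_packet_code:
  assumes "k > 0" "m \<le> crossed m (state_history k s t) (k - 1)" "w < 2 ^ m"
  shows "message_estimate k t (source_code m) (relay_code m) (packet_decoder m k) w s = w"
proof -
  have "crossed m (state_history k s t) (k - 1) = m"
    using assms(2) crossed_le by (intro antisym)
  then show ?thesis
    using received_packets[of "k - 1" k m w s t] assms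
    by (simp add: message_estimate_def packet_decoder_def horner_sum_bit_eq_take_bit take_bit_nat_eq_self del: upt_Suc)
qed

section \<open>The information front\<close>

text \<open>\<open>F\<close> is the furthest node that may hold any information about the message.
  It stops at \<open>k\<close>, where there is no outgoing channel.\<close>

definition front_step :: "nat \<Rightarrow> nat \<Rightarrow> bool list \<Rightarrow> nat" where
  "front_step k F c = F + of_bool (F < k \<and> c ! F)"

definition front :: "nat \<Rightarrow> nat \<Rightarrow> state_history \<Rightarrow> nat" where
  "front k F h = foldl (front_step k) F h"

text \<open>Induction over time: a node not yet reached has seen outputs that do not depend on the
  message, so what it sends does not depend on it either.\<close>

lemma channel_output_ahead_of_front:
  assumes "front k 0 (state_history k s n) \<le> i" "i < k" "1 \<le> l" "l \<le> n"
  shows "channel_output k f g w s i l = channel_output k f g w' s i l"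
  using assms
proof (induction n arbitrary: i l)
  case (Suc n)
  let ?F = "front k 0 (state_history k s n)"
  have F: "front k 0 (state_history k s (Suc n)) = front_step k ?F (global_state k s (Suc n))"
    by (simp add: front_def state_history_Suc)
  have le: "?F \<le> i" using Suc.prems(1) by (simp add: F front_step_def)
  show ?case
  proof (cases "l = Suc n \<and> s (i, Suc n)")
    case False
    then show ?thesis
      using Suc.IH[OF le, of l] Suc.prems
      by (cases "l = Suc n") (auto simp: channel_output_def erasure_output_def)
  next
    case True
    \<comment> \<open>A front at node \<open>i\<close> would have moved past it over the unerased
      channel.\<close>
    have "?F \<noteq> i"
      using Suc.prems True by (auto simp: F front_step_def global_state_def)
    with le obtain j where j: "i = Suc j" "?F \<le> j" by (cases i) auto
    have "channel_output k f g w s j l = channel_output k f g w' s j l" if "1 \<le> l" "l \<le> n" for l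
      using Suc.IH[of j l] j that Suc.prems by simp
    then have *: "map (channel_output k f g w s j) [1..<Suc n] = map (channel_output k f g w' s j) [1..<Suc n]"
      by (intro map_cong) auto
    have "channel_input k f g w s (Suc j) (Suc n) = channel_input k f g w' s (Suc j) (Suc n)"
      by (simp only: channel_input_Suc *)
    then show ?thesis
      using True j by (simp only: channel_output_def)
  qed
qed simp

lemma message_estimate_before_front:
  assumes "front k 0 (state_history k s t) < k"
  shows "message_estimate k t f g d w s = message_estimate k t f g d w' s"
proof -
  have *: "map (channel_output k f g w s (k - 1)) [1..<Suc t] =
      map (channel_output k f g w' s (k - 1)) [1..<Suc t]"
    using assms by (intro map_cong channel_output_ahead_of_front[where n = t]) auto
  show ?thesis unfolding message_estimate_def * ..
qed

lemma prob_bind_bernoulli: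
  fixes G :: "bool \<Rightarrow> 'a pmf"
  assumes "0 \<le> p" "p \<le> 1"
  shows "measure_pmf.prob (bind_pmf (bernoulli_pmf p) G) A =
    p * measure_pmf.prob (G True) A + (1 - p) * measure_pmf.prob (G False) A"
proof -
  have "ennreal (measure_pmf.prob (bind_pmf (bernoulli_pmf p) G) A) = emeasure (bind_pmf (bernoulli_pmf p) G) A"
    by (simp only: measure_pmf.emeasure_eq_measure)
  also have "\<dots> = (\<integral>\<^sup>+b. emeasure (G b) A \<partial>bernoulli_pmf p)"
    by (rule emeasure_bind_pmf)
  also have "\<dots> = ennreal (p * measure_pmf.prob (G True) A + (1 - p) * measure_pmf.prob (G False) A)"
    using assms by (simp add: measure_pmf.emeasure_eq_measure ennreal_mult mult_ac)
  finally show ?thesis using assms by (subst (asm) ennreal_inj) auto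
qed

text \<open>Each step multiplies the mean of \<open>z\<close> to the power of the front by at most
  \<open>1 - p + p * z\<close>, and Markov's inequality gives the bound. The proof conditions on the
  first column, hence the arbitrary start \<open>F\<close>.\<close>

lemma prob_front_le:
  assumes "0 \<le> p" "p \<le> 1" "1 \<le> z" "F \<le> k"
  shows "measure_pmf.prob (replicate_pmf t (replicate_pmf k (bernoulli_pmf p)))
     {h. k \<le> front k F h} \<le> (1 - p + p * z) ^ t * z ^ F / z ^ k"
  using assms(4)
proof (induction t arbitrary: F)
  case 0
  have "(if k = F then 1 else 0) \<le> z ^ F / z ^ k"
    using assms(3) by auto
  then show ?case using 0 assms(3) by (simp add: front_def indicator_def)
next
  case (Suc t)
  let ?C = "replicate_pmf k (bernoulli_pmf p)"
  let ?H = "replicate_pmf t ?C"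
  let ?P = "\<lambda>F. measure_pmf.prob ?H {h. k \<le> front k F h}"
  show ?case
  proof (cases "F = k")
    case True
    \<comment> \<open>A front that has arrived makes the probability 1, and the bound is at least 1
      because \<open>z \<ge> 1\<close>.\<close>
    have "1 \<le> 1 + p * (z - 1)" using assms by simp
    then have "1 \<le> (1 - p + p * z) ^ Suc t" by (intro one_le_power) (simp add: algebra_simps)
    then have "1 \<le> (1 - p + p * z) ^ Suc t * z ^ F / z ^ k" using True assms(3) by simp
    then show ?thesis by (rule order.trans[OF measure_pmf.prob_le_1])
  next
    case False
    then have F: "F < k" using Suc.prems by simp
    have "map_pmf (\<lambda>h. front k F h) (replicate_pmf (Suc t) ?C) =
       ?C \<bind> (\<lambda>c. map_pmf (front k (F + of_bool (c ! F))) ?H)"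
      using F by (simp add: map_bind_pmf front_def front_step_def) (simp add: map_pmf_def front_def)
    also have "\<dots> = map_pmf (\<lambda>c. c ! F) ?C \<bind> (\<lambda>b. map_pmf (front k (F + of_bool b)) ?H)"
      by (simp add: bind_map_pmf)
    also have "\<dots> = bernoulli_pmf p \<bind> (\<lambda>b. map_pmf (front k (F + of_bool b)) ?H)"
      using F by (simp add: map_nth_replicate_pmf)
    finally have "measure_pmf.prob (map_pmf (\<lambda>h. front k F h) (replicate_pmf (Suc t) ?C)) {k..} =
        p * ?P (Suc F) + (1 - p) * ?P F"
      using assms by (simp add: prob_bind_bernoulli vimage_def)
    moreover have "measure_pmf.prob (map_pmf (\<lambda>h. front k F h) (replicate_pmf (Suc t) ?C)) {k..} =
        measure_pmf.prob (replicate_pmf (Suc t) ?C) {h. k \<le> front k F h}"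
      by (simp add: vimage_def del: replicate_pmf.simps)
    ultimately have "measure_pmf.prob (replicate_pmf (Suc t) ?C) {h. k \<le> front k F h} =
        p * ?P (Suc F) + (1 - p) * ?P F" by simp
    also have "\<dots> \<le> p * ((1 - p + p * z) ^ t * z ^ Suc F / z ^ k) +
        (1 - p) * ((1 - p + p * z) ^ t * z ^ F / z ^ k)"
      using assms F by (intro add_mono mult_left_mono Suc.IH) auto
    also have "\<dots> = (1 - p + p * z) ^ Suc t * z ^ F / z ^ k"
      by (simp add: field_simps flip: add_divide_distrib diff_divide_distrib)
    finally show ?thesis .
  qed
qed

section \<open>Error probabilities\<close>

text \<open>Decoding fails only if fewer than \<open>m\<close> packets have crossed the last
  channel. Intersecting with the support supplies \<open>w < 2 ^ m\<close>.\<close>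

lemma error_probability_packet_code_le:
  assumes "k > 0"
  shows "error_probability \<epsilon> m k t (source_code m) (relay_code m) (packet_decoder m k) \<le>
    measure_pmf.prob (replicate_pmf t (replicate_pmf k (bernoulli_pmf (1 - \<epsilon>))))
      {h. crossed m h (k - 1) < m}"
proof -
  let ?U = "pmf_of_set {0..<2 ^ m :: nat}"
  let ?S = "Pi_pmf ({0..<k} \<times> {1..t}) False (\<lambda>_. bernoulli_pmf (1 - \<epsilon>))"
  let ?X = "{(w, s). message_estimate k t (source_code m) (relay_code m) (packet_decoder m k) w s \<noteq> w}"
  let ?bad = "{h. crossed m h (k - 1) < m}"
  have "error_probability \<epsilon> m k t (source_code m) (relay_code m) (packet_decoder m k) =
      measure_pmf.prob (pair_pmf ?U ?S) (?X \<inter> set_pmf (pair_pmf ?U ?S))"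
    by (simp add: error_probability_def tandem_pmf_def measure_Int_set_pmf del: set_pair_pmf)
  also have "\<dots> \<le> measure_pmf.prob (pair_pmf ?U ?S) (snd -` ((\<lambda>s. state_history k s t) -` ?bad))"
  proof (rule measure_pmf.finite_measure_mono)
    show "?X \<inter> set_pmf (pair_pmf ?U ?S) \<subseteq> snd -` ((\<lambda>s. state_history k s t) -` ?bad)"
    proof
      fix v assume v: "v \<in> ?X \<inter> set_pmf (pair_pmf ?U ?S)"
      obtain w s where ws: "v = (w, s)" by force
      with v have "w < 2 ^ m" by simp
      with v ws show "v \<in> snd -` ((\<lambda>s. state_history k s t) -` ?bad)"
        using message_estimate_packet_code[OF assms, of m s t w] by force
    qed
  qed simp
  also have "\<dots> = measure_pmf.prob (map_pmf (\<lambda>s. state_history k s t) (map_pmf snd (pair_pmf ?U ?S))) ?bad"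
    by simp
  also have "\<dots> = measure_pmf.prob (replicate_pmf t (replicate_pmf k (bernoulli_pmf (1 - \<epsilon>)))) ?bad"
    unfolding map_snd_pair_pmf map_state_history_Pi_pmf ..
  finally show ?thesis .
qed

text \<open>A coupling: both tandems are driven by the same states, while arrivals and initial
  lengths are drawn in addition. With more than \<open>x\<close> departures and an initial content
  below \<open>y\<close>, at least \<open>m\<close> departures are packets that arrived
  later.\<close>

lemma prob_not_crossed_le:
  assumes "0 < l" "l < p" "p < 1" "k > 0" "real m + y \<le> x"
  shows "measure_pmf.prob (replicate_pmf t (replicate_pmf k (bernoulli_pmf p))) {h. crossed m h (k - 1) < m}
    \<le> measure_pmf.prob (replicate_pmf t (bernoulli_pmf l)) {ds. real (count_list ds True) \<le> x}
      + measure_pmf.prob (replicate_pmf k (queue_pmf p l)) {qs. y \<le> real (sum_list qs)}"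
proof -
  let ?Q = "replicate_pmf k (queue_pmf p l)"
  let ?X = "replicate_pmf t (pair_pmf (bernoulli_pmf l) (replicate_pmf k (bernoulli_pmf p)))"
  let ?J = "pair_pmf ?Q ?X"
  let ?dep = "\<lambda>(qs, xs). tandem_departures qs xs"
  let ?D = "{ds. real (count_list ds True) \<le> x}" and ?Y = "{qs. y \<le> real (sum_list qs)}"
  let ?bad = "{h. crossed m h (k - 1) < m}"
  have "replicate_pmf t (replicate_pmf k (bernoulli_pmf p)) = map_pmf (map snd) (map_pmf snd ?J)"
    by (simp add: map_snd_pair_pmf map_replicate_pmf)
  then have "measure_pmf.prob (replicate_pmf t (replicate_pmf k (bernoulli_pmf p))) ?bad =
      measure_pmf.prob ?J (snd -` (map snd -` ?bad) \<inter> set_pmf ?J)"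
    by (simp add: measure_Int_set_pmf del: set_pair_pmf)
  also have "\<dots> \<le> measure_pmf.prob ?J (?dep -` ?D \<union> fst -` ?Y)"
  proof (rule measure_pmf.finite_measure_mono)
    show "snd -` (map snd -` ?bad) \<inter> set_pmf ?J \<subseteq> ?dep -` ?D \<union> fst -` ?Y"
    proof
      fix v assume v: "v \<in> snd -` (map snd -` ?bad) \<inter> set_pmf ?J"
      obtain qs xs where qx: "v = (qs, xs)" by force
      have len: "length qs = k" "\<And>x. x \<in> set xs \<Longrightarrow> length (snd x) = k"
        using v by (auto simp: qx set_replicate_pmf)
      show "v \<in> ?dep -` ?D \<union> fst -` ?Y"
      proof (rule ccontr)
        assume "v \<notin> ?dep -` ?D \<union> fst -` ?Y"
        then have "real m + real (sum_list qs) \<le> real (count_list (tandem_departures qs xs) True)"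
          using assms(5) by (auto simp: qx)
        then have "int m \<le> 0 + int (count_list (tandem_departures qs xs) True) - int (sum_list qs)"
          by linarith
        then have "m \<le> foldl (count_step m) (\<lambda>_. 0) (map snd xs) (k - 1)"
          \<comment> \<open>At the start nothing has arrived, so \<open>A = 0\<close> and the bounds
            on the counts are at most 0.\<close>
          using assms(4) len by (intro crossed_ge_departures[where A = 0 and qs = qs]) auto
        with v show False by (simp add: crossed_def qx)
      qed
    qed
  qed simp
  also have "\<dots> \<le> measure_pmf.prob ?J (?dep -` ?D) + measure_pmf.prob ?J (fst -` ?Y)"
    by (rule measure_Un_le) auto
  also have "\<dots> = measure_pmf.prob (map_pmf ?dep ?J) ?D + measure_pmf.prob (map_pmf fst ?J) ?Y"
    by simp
  finally show ?thesis
    unfolding map_fst_pair_pmf tandem_departures_burke[OF assms(1-3)] .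
qed

section \<open>Exponential tails of queue contents, departures and the front\<close>

lemma nn_integral_exp_queue_pmf:
  assumes "0 < l" "l < p" "p < 1" "z \<ge> 0" and z: "l * (1 - p) / (p * (1 - l)) * z < 1"
  shows "(\<integral>\<^sup>+q. ennreal (z ^ q) \<partial>queue_pmf p l) =
    ennreal ((1 - l / p) + l / p * ((p - l) / (p * (1 - l)) * z / (1 - l * (1 - p) / (p * (1 - l)) * z)))"
proof -
  define \<gamma> where "\<gamma> = (p - l) / (p * (1 - l))"
  define \<rho> where "\<rho> = l * (1 - p) / (p * (1 - l))"
  have \<gamma>: "0 < \<gamma>" "\<gamma> < 1" "1 - \<gamma> = \<rho>"
    using queue_param[OF assms(1-3)] by (auto simp: \<gamma>_def \<rho>_def)
  have \<rho>: "0 \<le> \<rho>" "\<rho> * z < 1" using z \<gamma> by (auto simp: \<rho>_def)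
  have b: "0 \<le> l / p" "l / p \<le> 1" using assms by auto
  have "(\<lambda>n. (\<rho> * z) ^ n) sums (1 / (1 - \<rho> * z))"
    using \<rho> assms(4) by (intro geometric_sums) auto
  then have "(\<lambda>n. \<gamma> * z * (\<rho> * z) ^ n) sums (\<gamma> * z * (1 / (1 - \<rho> * z)))"
    by (rule sums_mult)
  then have "(\<Sum>n. ennreal (\<gamma> * z * (\<rho> * z) ^ n)) = ennreal (\<gamma> * z * (1 / (1 - \<rho> * z)))"
    using \<gamma> \<rho> assms(4) by (intro suminf_ennreal_eq) auto
  moreover have "(\<integral>\<^sup>+n. ennreal (z ^ Suc n) \<partial>geometric_pmf \<gamma>) = (\<Sum>n. ennreal (\<gamma> * z * (\<rho> * z) ^ n))"
  proof (subst nn_integral_measure_pmf, subst nn_integral_count_space_nat, intro suminf_cong)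
    fix n
    have "pmf (geometric_pmf \<gamma>) n * z ^ Suc n = \<gamma> * z * (\<rho> * z) ^ n"
      using \<gamma> by (simp add: power_mult_distrib)
    then show "ennreal (pmf (geometric_pmf \<gamma>) n) * ennreal (z ^ Suc n) = ennreal (\<gamma> * z * (\<rho> * z) ^ n)"
      using assms(4) by (metis ennreal_mult pmf_nonneg zero_le_power)
  qed
  ultimately have geo: "(\<integral>\<^sup>+n. ennreal (z ^ Suc n) \<partial>geometric_pmf \<gamma>) = ennreal (\<gamma> * z / (1 - \<rho> * z))"
    by simp
  have "(\<integral>\<^sup>+q. ennreal (z ^ q) \<partial>queue_pmf p l) =
      ennreal (\<gamma> * z / (1 - \<rho> * z)) * ennreal (l / p) + ennreal (1 - l / p)"
    using b geo by (simp add: queue_pmf_def \<gamma>_def[symmetric] del: power_Suc)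
  also have "\<dots> = ennreal ((1 - l / p) + l / p * (\<gamma> * z / (1 - \<rho> * z)))"
  proof -
    have *: "ennreal u * ennreal a + ennreal (1 - a) = ennreal ((1 - a) + a * u)"
      if "0 \<le> a" "a \<le> 1" "0 \<le> u" for a u :: real
      using that by (simp add: ennreal_plus ennreal_mult mult.commute add.commute)
    show ?thesis by (rule *) (use b \<gamma> \<rho> assms(4) in auto)
  qed
  finally show ?thesis unfolding \<gamma>_def \<rho>_def .
qed

text \<open>Used with a Chernoff factor \<open>\<phi>\<close> that equals 1 at 0: a negative slope
  there gives some tilt with factor below 1. \<open>P\<close> carries a side condition such as
  convergence of a series.\<close>

lemma ex_exp_less:
  fixes \<phi> :: "real \<Rightarrow> real"
  assumes "(\<phi> has_real_derivative D) (at 0)" "D < 0" "eventually P (at_right 0)"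
  obtains \<theta> where "\<theta> > 0" "\<phi> \<theta> < \<phi> 0" "P \<theta>"
proof -
  obtain d where d: "d > 0" "\<And>h. 0 < h \<Longrightarrow> h < d \<Longrightarrow> \<phi> h < \<phi> 0"
    using DERIV_neg_dec_right[OF assms(1,2)] by auto
  have "eventually (\<lambda>\<theta>. 0 < \<theta> \<and> \<theta> < d) (at_right (0::real))"
    using d(1) by (auto simp: eventually_at_right_field)
  with assms(3) have "eventually (\<lambda>\<theta>. \<theta> > 0 \<and> \<phi> \<theta> < \<phi> 0 \<and> P \<theta>) (at_right 0)"
    by eventually_elim (use d in auto)
  then obtain \<theta> where "\<theta> > 0 \<and> \<phi> \<theta> < \<phi> 0 \<and> P \<theta>"
    using eventually_happens by fastforce
  with that show ?thesis by blast
qed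

lemma queue_sum_tail:
  assumes "0 < l" "l < p" "p < 1" "l * (1 - l) / (p - l) < c"
  obtains r where "0 < r" "r < 1"
    "\<And>k. measure_pmf.prob (replicate_pmf k (queue_pmf p l)) {qs. c * real k \<le> real (sum_list qs)} \<le> r ^ k"
proof -
  define \<gamma> where "\<gamma> = (p - l) / (p * (1 - l))"
  define \<rho> where "\<rho> = l * (1 - p) / (p * (1 - l))"
  have \<gamma>: "0 < \<gamma>" "\<gamma> < 1" "1 - \<rho> = \<gamma>"
    using queue_param[OF assms(1-3)] by (auto simp: \<gamma>_def \<rho>_def)
  define \<phi> where "\<phi> = (\<lambda>\<theta>. ((1 - l / p) + l / p * (\<gamma> * exp \<theta> / (1 - \<rho> * exp \<theta>))) * exp (- c * \<theta>))"
  have 1: "\<phi> 0 = 1" using \<gamma> by (simp add: \<phi>_def)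
  have \<rho>: "\<rho> = 1 - \<gamma>" using \<gamma>(3) by simp
  \<comment> \<open>The slope is the stationary mean \<open>l * (1 - l) / (p - l)\<close> minus
    \<open>c\<close>.\<close>
  have "(\<phi> has_real_derivative l / (p * \<gamma>) - c) (at 0)"
    unfolding \<phi>_def \<rho> using \<gamma>(1) assms(1-3)
    by (auto intro!: derivative_eq_intros simp: field_simps power2_eq_square)
  moreover have "l / (p * \<gamma>) - c < 0"
    using assms by (simp add: \<gamma>_def)
  moreover have "((\<lambda>\<theta>. \<rho> * exp \<theta>) \<longlongrightarrow> \<rho> * exp 0) (at_right 0)"
    by (intro tendsto_intros)
  then have "eventually (\<lambda>\<theta>. \<rho> * exp \<theta> < 1) (at_right 0)"
    by (rule order_tendstoD) (use \<gamma> in simp)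
  ultimately obtain \<theta> where \<theta>: "\<theta> > 0" "\<phi> \<theta> < \<phi> 0" "\<rho> * exp \<theta> < 1"
    by (rule ex_exp_less)
  have pos: "0 < (1 - l / p) + l / p * (\<gamma> * exp \<theta> / (1 - \<rho> * exp \<theta>))"
    using assms \<gamma> \<theta> by (intro add_pos_nonneg) auto
  show ?thesis
  proof (rule that)
    show "0 < \<phi> \<theta>" using pos by (simp add: \<phi>_def)
    show "\<phi> \<theta> < 1" using \<theta> 1 by simp
    fix k
    let ?R = "replicate_pmf k (queue_pmf p l)"
    let ?g = "\<lambda>q. \<theta> * (real q - c)"
    have "(\<integral>\<^sup>+q. ennreal (exp (?g q)) \<partial>queue_pmf p l) =
       (\<integral>\<^sup>+q. ennreal (exp \<theta> ^ q) * ennreal (exp (- c * \<theta>)) \<partial>queue_pmf p l)"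
      by (intro nn_integral_cong)
         (simp flip: ennreal_mult exp_of_nat_mult exp_add, simp add: algebra_simps)
    also have "\<dots> = ennreal (\<phi> \<theta>)"
      using assms \<theta> pos nn_integral_exp_queue_pmf[of l p "exp \<theta>"]
      by (simp add: nn_integral_multc \<phi>_def ennreal_mult \<gamma>_def \<rho>_def)
    finally have int: "(\<integral>\<^sup>+q. ennreal (exp (?g q)) \<partial>queue_pmf p l) \<le> ennreal (\<phi> \<theta>)" by simp
    have sum: "sum_list (map ?g qs) = \<theta> * (real (sum_list qs) - c * real (length qs))" for qs
      by (induction qs) (simp_all add: algebra_simps)
    \<comment> \<open>On the support the list has length \<open>k\<close>, which turns the event
      into a sum of \<open>k\<close> centred terms.\<close>
    have "measure_pmf.prob ?R {qs. c * real k \<le> real (sum_list qs)} =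
        measure_pmf.prob ?R ({qs. c * real k \<le> real (sum_list qs)} \<inter> set_pmf ?R)"
      by (simp add: measure_Int_set_pmf)
    also have "\<dots> \<le> measure_pmf.prob ?R {qs. sum_list (map ?g qs) \<ge> 0}"
      using \<theta>(1) by (intro measure_pmf.finite_measure_mono) (auto simp: sum set_replicate_pmf)
    also have "\<dots> \<le> \<phi> \<theta> ^ k"
      using pos by (intro chernoff_replicate_pmf int) (simp add: \<phi>_def)
    finally show "measure_pmf.prob ?R {qs. c * real k \<le> real (sum_list qs)} \<le> \<phi> \<theta> ^ k" .
  qed
qed

text \<open>A lower tail below the mean \<open>l\<close>; here \<open>\<phi>\<close> is the moment
  generating function of \<open>c - of_bool b\<close>.\<close>

lemma departures_tail:
  assumes "0 < l" "l < 1" "c < l"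
  obtains r where "0 < r" "r < 1"
    "\<And>t. measure_pmf.prob (replicate_pmf t (bernoulli_pmf l)) {ds. real (count_list ds True) \<le> c * real t} \<le> r ^ t"
proof -
  define \<phi> where "\<phi> = (\<lambda>\<theta>. (exp (- \<theta>) * l + (1 - l)) * exp (c * \<theta>))"
  have 1: "\<phi> 0 = 1" by (simp add: \<phi>_def)
  have "(\<phi> has_real_derivative c - l) (at 0)"
    unfolding \<phi>_def by (auto intro!: derivative_eq_intros)
  moreover have "c - l < 0" using assms by simp
  ultimately obtain \<theta> where \<theta>: "\<theta> > 0" "\<phi> \<theta> < \<phi> 0"
    by (rule ex_exp_less[where P = "\<lambda>_. True"]) auto
  have pos: "0 < exp (- \<theta>) * l + (1 - l)" using assms by (intro add_pos_pos) auto
  show ?thesis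
  proof (rule that)
    show "0 < \<phi> \<theta>" using pos by (simp add: \<phi>_def)
    show "\<phi> \<theta> < 1" using \<theta> 1 by simp
    fix t
    let ?R = "replicate_pmf t (bernoulli_pmf l)"
    let ?g = "\<lambda>b::bool. \<theta> * (c - of_bool b)"
    have "(\<integral>\<^sup>+b. ennreal (exp (?g b)) \<partial>bernoulli_pmf l) =
        ennreal (exp (\<theta> * (c - 1))) * ennreal l + ennreal (exp (\<theta> * c)) * ennreal (1 - l)"
      using assms by simp
    also have "\<dots> = ennreal (exp (\<theta> * (c - 1)) * l + exp (\<theta> * c) * (1 - l))"
      using assms by (simp add: ennreal_mult ennreal_plus)
    also have "exp (\<theta> * (c - 1)) * l + exp (\<theta> * c) * (1 - l) = \<phi> \<theta>"
      by (simp add: \<phi>_def algebra_simps exp_diff exp_minus divide_inverse)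
    finally have int: "(\<integral>\<^sup>+b. ennreal (exp (?g b)) \<partial>bernoulli_pmf l) \<le> ennreal (\<phi> \<theta>)" by simp
    have sum: "sum_list (map ?g ds) = \<theta> * (c * real (length ds) - real (count_list ds True))" for ds
      by (induction ds) (simp_all add: algebra_simps)
    have "measure_pmf.prob ?R {ds. real (count_list ds True) \<le> c * real t} =
        measure_pmf.prob ?R ({ds. real (count_list ds True) \<le> c * real t} \<inter> set_pmf ?R)"
      by (simp add: measure_Int_set_pmf)
    also have "\<dots> \<le> measure_pmf.prob ?R {ds. sum_list (map ?g ds) \<ge> 0}"
      using \<theta>(1) by (intro measure_pmf.finite_measure_mono) (auto simp: sum set_replicate_pmf)
    also have "\<dots> \<le> \<phi> \<theta> ^ t"
      using pos by (intro chernoff_replicate_pmf int) (simp add: \<phi>_def)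
    finally show "measure_pmf.prob ?R {ds. real (count_list ds True) \<le> c * real t} \<le> \<phi> \<theta> ^ t" .
  qed
qed

lemma front_tail:
  assumes "0 < p" "p < 1" "0 < c" "c * p < 1"
  obtains r where "0 < r" "r < 1"
    "\<And>k t. real t \<le> c * real k \<Longrightarrow>
      measure_pmf.prob (replicate_pmf t (replicate_pmf k (bernoulli_pmf p))) {h. k \<le> front k 0 h} \<le> r ^ k"
proof -
  define \<phi> where "\<phi> = (\<lambda>\<theta>. exp (c * ln (1 - p + p * exp \<theta>) - \<theta>))"
  have 1: "\<phi> 0 = 1" by (simp add: \<phi>_def)
  have "(\<phi> has_real_derivative c * p - 1) (at 0)"
    unfolding \<phi>_def by (auto intro!: derivative_eq_intros)
  moreover have "c * p - 1 < 0" using assms by simp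
  ultimately obtain \<theta> where \<theta>: "\<theta> > 0" "\<phi> \<theta> < \<phi> 0"
    by (rule ex_exp_less[where P = "\<lambda>_. True"]) auto
  define b where "b = 1 - p + p * exp \<theta>"
  have "p * 1 \<le> p * exp \<theta>" using assms \<theta> by (intro mult_left_mono) auto
  \<comment> \<open>This monotonicity lets \<open>t\<close> be replaced by its upper bound
    \<open>c * real k\<close>.\<close>
  then have b: "b \<ge> 1" by (simp add: b_def)
  show ?thesis
  proof (rule that)
    show "0 < \<phi> \<theta>" by (simp add: \<phi>_def)
    show "\<phi> \<theta> < 1" using \<theta> 1 by simp
    fix k t assume t: "real t \<le> c * real k"
    have "measure_pmf.prob (replicate_pmf t (replicate_pmf k (bernoulli_pmf p))) {h. k \<le> front k 0 h} \<le>
        b ^ t / exp \<theta> ^ k"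
      using prob_front_le[of p "exp \<theta>" 0 k t] assms \<theta> by (simp add: b_def)
    also have "b ^ t = exp (real t * ln b)" using b by (simp add: exp_of_nat_mult)
    also have "\<dots> \<le> exp (c * real k * ln b)"
      using t b by (simp add: mult_right_mono)
    also have "exp (c * real k * ln b) / exp \<theta> ^ k = \<phi> \<theta> ^ k"
      by (simp add: \<phi>_def b_def algebra_simps flip: exp_of_nat_mult exp_diff)
    finally show "measure_pmf.prob (replicate_pmf t (replicate_pmf k (bernoulli_pmf p))) {h. k \<le> front k 0 h} \<le> \<phi> \<theta> ^ k"
      by (simp add: divide_right_mono)
  qed
qed

text \<open>Before the front arrives the estimate is a fixed guess \<open>e\<close> given the
  states, and a guess hits a uniform message of at least one bit with probability at most
  1/2.\<close>

lemma error_probability_ge: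
  assumes "m \<ge> 1"
  shows "error_probability \<epsilon> m k t f g d \<ge> (1 -
    measure_pmf.prob (replicate_pmf t (replicate_pmf k (bernoulli_pmf (1 - \<epsilon>)))) {h. k \<le> front k 0 h}) / 2"
proof -
  let ?U = "pmf_of_set {0..<2 ^ m :: nat}"
  let ?S = "Pi_pmf ({0..<k} \<times> {1..t}) False (\<lambda>_. bernoulli_pmf (1 - \<epsilon>))"
  let ?H = "replicate_pmf t (replicate_pmf k (bernoulli_pmf (1 - \<epsilon>)))"
  let ?X = "{(w, s). message_estimate k t f g d w s \<noteq> w}"
  let ?G = "{h. front k 0 h < k}"
  define c :: real where "c = 1 / 2"
  have half: "ennreal c * indicator ?G (state_history k s t) \<le> emeasure ?U {w. message_estimate k t f g d w s \<noteq> w}" for s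
  proof (cases "front k 0 (state_history k s t) < k")
    case True
    define e where "e = message_estimate k t f g d 0 s"
    have "message_estimate k t f g d w s = e" for w
      unfolding e_def by (rule message_estimate_before_front[OF True])
    then have "{w. message_estimate k t f g d w s \<noteq> w} = - {e}"
      by auto
    moreover have "measure_pmf.prob ?U {e} \<le> 1 / 2"
    proof -
      have "(2::real) ^ 1 \<le> 2 ^ m" using assms by (intro power_increasing) auto
      moreover have "measure_pmf.prob ?U {e} \<le> 1 / 2 ^ m"
        by (simp add: measure_pmf_single indicator_def)
      ultimately show ?thesis
        by (smt (verit) frac_le power_one_right zero_less_one)
    qed
    then have "c \<le> measure_pmf.prob ?U (- {e})"
      unfolding c_def using measure_pmf.prob_compl[of "{e}" ?U] by (simp add: Compl_eq_Diff_UNIV)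
    ultimately have "ennreal c \<le> emeasure ?U {w. message_estimate k t f g d w s \<noteq> w}"
      by (simp add: measure_pmf.emeasure_eq_measure)
    with True show ?thesis by simp
  qed simp
  have "ennreal c * emeasure ?H ?G = (\<integral>\<^sup>+h. ennreal c * indicator ?G h \<partial>?H)"
    by (simp add: nn_integral_cmult_indicator)
  also have "\<dots> = (\<integral>\<^sup>+s. ennreal c * indicator ?G (state_history k s t) \<partial>?S)"
    unfolding map_state_history_Pi_pmf[symmetric] by (rule nn_integral_map_pmf)
  also have "\<dots> \<le> (\<integral>\<^sup>+s. emeasure ?U {w. message_estimate k t f g d w s \<noteq> w} \<partial>?S)"
    by (intro nn_integral_mono half)
  also have "\<dots> = emeasure (bind_pmf ?S (\<lambda>s. map_pmf (\<lambda>w. (w, s)) ?U)) ?X"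
    \<comment> \<open>The states are drawn first here; the next step swaps the order of the
      independent draws.\<close>
    by (simp add: vimage_def)
  also have "bind_pmf ?S (\<lambda>s. map_pmf (\<lambda>w. (w, s)) ?U) = pair_pmf ?U ?S"
    unfolding pair_pmf_def map_pmf_def by (rule bind_commute_pmf)
  finally have "ennreal (c * measure_pmf.prob ?H ?G) \<le> ennreal (error_probability \<epsilon> m k t f g d)"
    by (simp add: error_probability_def tandem_pmf_def measure_pmf.emeasure_eq_measure ennreal_mult c_def[THEN arg_cong[where f = "\<lambda>c. 0 \<le> c"]])
  then have "c * measure_pmf.prob ?H ?G \<le> error_probability \<epsilon> m k t f g d"
    by (subst (asm) ennreal_le_iff) (auto simp: error_probability_def)
  moreover have "?G = - {h. k \<le> front k 0 h}" by auto
  then have "measure_pmf.prob ?H ?G = 1 - measure_pmf.prob ?H {h. k \<le> front k 0 h}"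
    using measure_pmf.prob_compl[of "{h. k \<le> front k 0 h}" ?H] by (simp add: Compl_eq_Diff_UNIV)
  ultimately show ?thesis by (simp add: c_def)
qed

section \<open>Delay and velocity\<close>

text \<open>After taking logarithms and dividing by \<open>k\<close>, the left side tends to
  \<open>ln r < 0\<close> and the right side to 0. The factor 2 makes room for two tail
  bounds.\<close>

lemma eventually_geometric_less_threshold:
  fixes \<xi> :: "nat \<Rightarrow> real"
  assumes "\<And>k. k \<ge> 1 \<Longrightarrow> 0 < \<xi> k" "(\<lambda>k. 1 / real k * ln (1 / \<xi> k)) \<longlonglongrightarrow> 0"
    and "0 < r" "r < 1"
  shows "eventually (\<lambda>k. 2 * r ^ k < \<xi> k) sequentially"
proof -
  have "(\<lambda>k. ln 2 * (1 / real k) + 1 / real k * ln (1 / \<xi> k)) \<longlonglongrightarrow> ln 2 * 0 + 0"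
    by (intro tendsto_intros assms(2) lim_1_over_n)
  moreover have "ln 2 * 0 + 0 < - ln r" using assms by simp
  ultimately have "eventually (\<lambda>k. ln 2 * (1 / real k) + 1 / real k * ln (1 / \<xi> k) < - ln r) sequentially"
    by (rule order_tendstoD)
  then show ?thesis
    using eventually_ge_at_top[of 1]
  proof eventually_elim
    case (elim k)
    have \<xi>: "0 < \<xi> k" using assms(1) elim(2) by simp
    have "ln (2 * r ^ k) = ln 2 + real k * ln r"
      using assms(3) by (simp add: ln_mult ln_realpow)
    also have "\<dots> < ln (\<xi> k)"
      using elim \<xi> by (simp add: ln_div field_simps)
    finally show ?case using \<xi> assms(3) by simp
  qed
qed

lemma minimum_delay_le:
  "error_probability \<epsilon> m k t f g d < \<xi> \<Longrightarrow> minimum_delay m k \<epsilon> \<xi> \<le> enat t"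
  unfolding minimum_delay_def by (rule Inf_lower) blast

lemma minimum_delay_ge:
  assumes "\<And>t f g d. real t \<le> x \<Longrightarrow> \<xi> \<le> error_probability \<epsilon> m k t f g d"
  shows "ereal x \<le> ereal_of_enat (minimum_delay m k \<epsilon> \<xi>)"
proof -
  have "enat (nat \<lceil>x\<rceil>) \<le> minimum_delay m k \<epsilon> \<xi>"
    unfolding minimum_delay_def
  proof (rule Inf_greatest, clarify)
    fix t f g d assume "error_probability \<epsilon> m k t f g d < \<xi>"
    with assms[of t f g d] have "x < real t" by fastforce
    then show "enat (nat \<lceil>x\<rceil>) \<le> enat t" by (simp add: ceiling_le_iff nat_le_iff)
  qed
  then have "ereal_of_enat (enat (nat \<lceil>x\<rceil>)) \<le> ereal_of_enat (minimum_delay m k \<epsilon> \<xi>)"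
    by (simp only: ereal_of_enat_le_iff)
  moreover have "ereal x \<le> ereal_of_enat (enat (nat \<lceil>x\<rceil>))"
    by (simp add: real_nat_ceiling_ge)
  ultimately show ?thesis by (rule order.trans[rotated])
qed

lemma delay_achievable:
  fixes \<epsilon> :: real and \<xi> :: "nat \<Rightarrow> real"
  assumes \<epsilon>: "0 < \<epsilon>" "\<epsilon> < 1"
    and \<xi>: "\<And>k. k \<ge> 1 \<Longrightarrow> 0 < \<xi> k" "(\<lambda>k. 1 / real k * ln (1 / \<xi> k)) \<longlonglongrightarrow> 0"
    and "0 < \<alpha>" and m: "\<And>\<delta>. \<delta> > 0 \<Longrightarrow> eventually (\<lambda>k. real (m k) \<le> (\<alpha> + \<delta>) * real k) sequentially"
    and c: "(1 + 2 * sqrt (\<alpha> * \<epsilon>) + \<alpha>) / (1 - \<epsilon>) < c"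
  shows "eventually (\<lambda>k. minimum_delay (m k) k \<epsilon> (\<xi> k) \<le> enat (nat \<lceil>c * real k\<rceil>)) sequentially"
proof -
  define p where "p = 1 - \<epsilon>"
  \<comment> \<open>The minimiser of \<open>\<alpha> / l + (1 - l) / (p - l)\<close>, where
    \<open>sqrt \<alpha> / l = sqrt \<epsilon> / (p - l)\<close>.\<close>
  define l where "l = p * sqrt \<alpha> / (sqrt \<alpha> + sqrt \<epsilon>)"
  have p: "0 < p" "p < 1" using \<epsilon> by (auto simp: p_def)
  have sq: "0 < sqrt \<alpha>" "0 < sqrt \<epsilon>" using assms by auto
  have l: "0 < l" using p sq by (simp add: l_def divide_pos_pos add_pos_pos)
  have "p * sqrt \<alpha> < p * (sqrt \<alpha> + sqrt \<epsilon>)" using p sq by simp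
  then have "l < p" using sq unfolding l_def by (subst pos_divide_less_eq) (auto intro: add_pos_pos)
  note l = l this
  have opt: "\<alpha> / l + (1 - l) / (p - l) = (1 + 2 * sqrt (\<alpha> * \<epsilon>) + \<alpha>) / p"
  proof -
    have "\<alpha> / l = (\<alpha> + sqrt \<alpha> * sqrt \<epsilon>) / p"
      using p sq assms by (simp add: l_def field_simps)
    moreover have pl: "p - l = p * sqrt \<epsilon> / (sqrt \<alpha> + sqrt \<epsilon>)"
    proof -
      have "p - l = (p * (sqrt \<alpha> + sqrt \<epsilon>) - p * sqrt \<alpha>) / (sqrt \<alpha> + sqrt \<epsilon>)"
        using add_pos_pos[OF sq] by (simp add: l_def diff_divide_distrib)
      then show ?thesis by (simp add: algebra_simps)
    qed
    have "(1 - l) / (p - l) = 1 + \<epsilon> / (p - l)"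
      using l by (simp add: field_simps p_def)
    moreover have "\<epsilon> / (p - l) = (\<epsilon> + sqrt \<alpha> * sqrt \<epsilon>) / p"
      unfolding pl using p sq assms by (simp add: field_simps)
    ultimately have "\<alpha> / l + (1 - l) / (p - l) = 1 + (\<alpha> + \<epsilon> + 2 * (sqrt \<alpha> * sqrt \<epsilon>)) / p"
      by (simp add: add_divide_distrib)
    also have "\<dots> = (1 + 2 * sqrt (\<alpha> * \<epsilon>) + \<alpha>) / p"
      using p by (simp add: field_simps real_sqrt_mult p_def)
    finally show ?thesis .
  qed
  \<comment> \<open>The mean stationary length of one queue.\<close>
  define b where "b = l * (1 - l) / (p - l)"
  have "\<alpha> + b = l * (\<alpha> / l + (1 - l) / (p - l))"
    using l by (simp add: b_def algebra_simps)
  also have "\<dots> < l * c"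
    unfolding opt by (intro mult_strict_left_mono) (use c l in \<open>auto simp: p_def\<close>)
  finally have gap: "\<alpha> + b < l * c" .
  \<comment> \<open>A quarter of the gap per node: one \<open>\<delta>\<close> for the message size,
    one for the initial content, and the remaining two separate \<open>a\<close> from the departure
    rate \<open>l\<close>.\<close>
  define \<delta> where "\<delta> = (l * c - \<alpha> - b) / 4"
  have \<delta>: "\<delta> > 0" "l * c = \<alpha> + b + 4 * \<delta>" using gap by (auto simp: \<delta>_def field_simps)
  have b0: "b > 0" using l p by (simp add: b_def)
  then have c0: "c > 0" using \<delta> l assms by (metis add_pos_pos zero_less_mult_pos mult_pos_pos zero_less_numeral)
  define a where "a = (\<alpha> + b + 2 * \<delta>) / c"
  have a: "a < l" "a * c = \<alpha> + b + 2 * \<delta>" "a > 0"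
    using c0 \<delta> b0 assms by (auto simp: a_def field_simps)
  obtain r1 where r1: "0 < r1" "r1 < 1"
    "\<And>t. measure_pmf.prob (replicate_pmf t (bernoulli_pmf l)) {ds. real (count_list ds True) \<le> a * real t} \<le> r1 ^ t"
    using departures_tail[of l a] l p a by auto
  obtain r2 where r2: "0 < r2" "r2 < 1"
    "\<And>k. measure_pmf.prob (replicate_pmf k (queue_pmf p l)) {qs. (b + \<delta>) * real k \<le> real (sum_list qs)} \<le> r2 ^ k"
    using queue_sum_tail[of l p "b + \<delta>"] l p \<delta> by (auto simp: b_def)
  \<comment> \<open>Since \<open>t \<ge> c * real k\<close>, the power \<open>r1 powr c\<close>
    expresses the decay in \<open>t\<close> as a decay in \<open>k\<close>.\<close>
  define r where "r = max (r1 powr c) r2"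
  have "r1 powr c < 1 powr c" using r1(1,2) c0 by (intro powr_less_mono2) auto
  then have r: "0 < r" "r < 1"
    using r1(1) r2(1,2) by (auto simp: r_def less_max_iff_disj)
  have "eventually (\<lambda>k. real (m k) \<le> (\<alpha> + \<delta>) * real k) sequentially"
    using m \<delta> by auto
  moreover have "eventually (\<lambda>k. 2 * r ^ k < \<xi> k) sequentially"
    using \<xi> r by (rule eventually_geometric_less_threshold)
  ultimately show ?thesis
    using eventually_ge_at_top[of 1]
  proof eventually_elim
    case (elim k)
    define t where "t = nat \<lceil>c * real k\<rceil>"
    have t: "c * real k \<le> real t" using c0 by (simp add: t_def)
    have "(\<alpha> + b + 2 * \<delta>) * real k = a * (c * real k)"
      by (simp flip: a(2))
    also have "\<dots> \<le> a * real t"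
      using t a by (intro mult_left_mono) auto
    finally have mx: "real (m k) + (b + \<delta>) * real k \<le> a * real t"
      using elim(1) by (simp add: algebra_simps)
    have "r1 ^ t = r1 powr real t" using r1 by (simp add: powr_realpow)
    also have "\<dots> \<le> r1 powr (c * real k)"
      using r1 t by (intro powr_mono') auto
    also have "\<dots> = (r1 powr c) ^ k"
      using r1 by (simp add: powr_powr flip: powr_realpow)
    also have "\<dots> \<le> r ^ k" by (intro power_mono) (auto simp: r_def)
    finally have r1k: "r1 ^ t \<le> r ^ k" .
    have r2k: "r2 ^ k \<le> r ^ k" using r2 by (intro power_mono) (auto simp: r_def)
    have "error_probability \<epsilon> (m k) k t (source_code (m k)) (relay_code (m k)) (packet_decoder (m k) k)
        \<le> measure_pmf.prob (replicate_pmf t (replicate_pmf k (bernoulli_pmf p))) {h. crossed (m k) h (k - 1) < m k}"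
      using error_probability_packet_code_le[of k] elim by (simp add: p_def)
    also have "\<dots> \<le> r1 ^ t + r2 ^ k"
      using prob_not_crossed_le[OF l p(2) _ mx, where k = k and t = t] r1(3)[of t] r2(3)[of k] elim by simp
    also have "\<dots> < \<xi> k" using r1k r2k elim by simp
    finally show ?case
      unfolding t_def by (rule minimum_delay_le)
  qed
qed

lemma information_velocity_geI:
  assumes "V > 0"
    and "\<And>c. 1 / V < c \<Longrightarrow> eventually (\<lambda>k. minimum_delay (m k) k \<epsilon> (\<xi> k) \<le> enat (nat \<lceil>c * real k\<rceil>)) sequentially"
  shows "ereal V \<le> information_velocity \<epsilon> m \<xi>"
proof (rule dense_le)
  fix x assume "x < ereal V"
  then have "max x 0 < ereal V" using assms(1) by simp
  then obtain z where z: "max x 0 < ereal z" "ereal z < ereal V" by (metis ereal_dense2)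
  then have zV: "0 < z" "z < V" "x \<le> ereal z" by (auto simp: less_imp_le)
  then have "1 / V < 1 / z" by (simp add: frac_less2)
  \<comment> \<open>The room between \<open>c\<close> and \<open>1 / z\<close> absorbs the rounding
    up of the delay as soon as \<open>k \<ge> K\<close>.\<close>
  then obtain c where c: "1 / V < c" "c < 1 / z" using dense by blast
  have c0: "0 < c" using c(1) assms(1) by (meson less_trans zero_less_divide_1_iff)
  define K where "K = nat \<lceil>1 / (1 / z - c)\<rceil>"
  have "eventually (\<lambda>k. ereal z \<le> ereal (real k) / ereal_of_enat (minimum_delay (m k) k \<epsilon> (\<xi> k))) sequentially"
    using assms(2)[OF c(1)] eventually_ge_at_top[of "max 1 K"]
  proof eventually_elim
    case (elim k)
    then obtain t where t: "minimum_delay (m k) k \<epsilon> (\<xi> k) = enat t" "t \<le> nat \<lceil>c * real k\<rceil>"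
      by (metis enat_ord_simps(1) enat_ile)
    have "1 / (1 / z - c) \<le> real k" using elim(2) by (simp add: K_def ceiling_le_iff nat_le_iff)
    then have "1 \<le> (1 / z - c) * real k" using c by (simp add: field_simps)
    moreover have "real t \<le> c * real k + 1"
    proof -
      have "real t \<le> real (nat \<lceil>c * real k\<rceil>)" using t(2) by simp
      also have "\<dots> \<le> c * real k + 1" using c0 by simp
      finally show ?thesis .
    qed
    ultimately have "real t \<le> real k / z" by (simp add: algebra_simps)
    then have "z * real t \<le> real k" using zV by (simp add: field_simps)
    then show ?case
      \<comment> \<open>A delay of 0 makes the extended real quotient infinite.\<close>
      using elim(2) t by (cases "t = 0") (auto simp: field_simps)
  qed
  then have "ereal z \<le> information_velocity \<epsilon> m \<xi>"
    unfolding information_velocity_def by (rule Liminf_bounded)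
  with zV(3) show "x \<le> information_velocity \<epsilon> m \<xi>" by (rule order.trans)
qed

text \<open>For any \<open>z > V\<close> the choice \<open>c = 1 / z\<close> bounds the quotient
  eventually by \<open>z\<close>; an infinite delay gives quotient 0.\<close>

lemma information_velocity_leI:
  assumes "V > 0"
    and "\<And>c. 0 < c \<Longrightarrow> c * V < 1 \<Longrightarrow>
      eventually (\<lambda>k. ereal (c * real k) \<le> ereal_of_enat (minimum_delay (m k) k \<epsilon> (\<xi> k))) sequentially"
  shows "information_velocity \<epsilon> m \<xi> \<le> ereal V"
proof (rule dense_ge)
  fix x assume "ereal V < x"
  then obtain z where z: "ereal V < ereal z" "ereal z < x" by (metis ereal_dense2)
  then have zV: "0 < z" "V < z" using assms(1) by auto
  have "eventually (\<lambda>k. ereal (1 / z * real k) \<le> ereal_of_enat (minimum_delay (m k) k \<epsilon> (\<xi> k))) sequentially"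
    using zV by (intro assms(2)) auto
  then have "eventually (\<lambda>k. ereal (real k) / ereal_of_enat (minimum_delay (m k) k \<epsilon> (\<xi> k)) \<le> ereal z) sequentially"
    using eventually_ge_at_top[of 1]
  proof eventually_elim
    case (elim k)
    show ?case
    proof (cases "minimum_delay (m k) k \<epsilon> (\<xi> k)")
      case (enat t)
      then have "real k \<le> z * real t" using elim(1) zV by (simp add: field_simps)
      then show ?thesis
        using elim(2) zV enat by (cases "t = 0") (auto simp: field_simps)
    qed (use zV in simp)
  qed
  then have "limsup (\<lambda>k. ereal (real k) / ereal_of_enat (minimum_delay (m k) k \<epsilon> (\<xi> k))) \<le> ereal z"
    by (rule Limsup_bounded)
  then have "information_velocity \<epsilon> m \<xi> \<le> ereal z"
    unfolding information_velocity_def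
    using Liminf_le_Limsup[OF sequentially_bot] by (rule order.trans[rotated])
  with z show "information_velocity \<epsilon> m \<xi> \<le> x" by simp
qed

lemma information_velocity_le:
  fixes \<epsilon> :: real and \<xi> :: "nat \<Rightarrow> real"
  assumes "0 < \<epsilon>" "\<epsilon> < 1" and "\<xi> \<longlonglongrightarrow> 0" and m: "\<And>k. k \<ge> 1 \<Longrightarrow> m k \<ge> 1"
  shows "information_velocity \<epsilon> m \<xi> \<le> ereal (1 - \<epsilon>)"
proof (rule information_velocity_leI)
  fix c :: real assume c: "0 < c" "c * (1 - \<epsilon>) < 1"
  obtain r where r: "0 < r" "r < 1" "\<And>k t. real t \<le> c * real k \<Longrightarrow>
      measure_pmf.prob (replicate_pmf t (replicate_pmf k (bernoulli_pmf (1 - \<epsilon>)))) {h. k \<le> front k 0 h} \<le> r ^ k"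
    using front_tail[of "1 - \<epsilon>" c] assms c by auto
  have "(\<lambda>k. r ^ k) \<longlonglongrightarrow> 0" using r by (intro LIMSEQ_realpow_zero) auto
  \<comment> \<open>With \<open>r ^ k\<close> below 1/2 the error probability exceeds 1/4, and hence
    the threshold.\<close>
  then have "eventually (\<lambda>k. r ^ k < 1 / 2) sequentially" by (rule order_tendstoD) simp
  moreover have "eventually (\<lambda>k. \<xi> k < 1 / 4) sequentially"
    using assms(3) by (rule order_tendstoD) simp
  ultimately show "eventually (\<lambda>k. ereal (c * real k) \<le> ereal_of_enat (minimum_delay (m k) k \<epsilon> (\<xi> k))) sequentially"
    using eventually_ge_at_top[of 1]
  proof eventually_elim
    case (elim k)
    show ?case
    proof (rule minimum_delay_ge)
      fix t f g d assume "real t \<le> c * real k"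
      then show "\<xi> k \<le> error_probability \<epsilon> (m k) k t f g d"
        using r(3)[of t k] error_probability_ge[OF m[OF elim(3)], where \<epsilon> = \<epsilon> and k = k and t = t and f = f and g = g and d = d] elim
        by (simp add: field_simps)
    qed
  qed
qed (use assms in simp)

text \<open>The growth of \<open>m\<close> is bounded from above only, so that sublinear sizes
  qualify for every \<open>\<alpha> > 0\<close>.\<close>

lemma information_velocity_ge_linear:
  fixes \<epsilon> :: real and \<xi> :: "nat \<Rightarrow> real"
  assumes \<epsilon>: "0 < \<epsilon>" "\<epsilon> < 1"
    and \<xi>: "\<And>k. k \<ge> 1 \<Longrightarrow> 0 < \<xi> k" "(\<lambda>k. 1 / real k * ln (1 / \<xi> k)) \<longlonglongrightarrow> 0"
    and "0 < \<alpha>" and m: "\<And>\<delta>. \<delta> > 0 \<Longrightarrow> eventually (\<lambda>k. real (m k) \<le> (\<alpha> + \<delta>) * real k) sequentially"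
  shows "ereal ((1 - \<epsilon>) / (1 + 2 * sqrt (\<alpha> * \<epsilon>) + \<alpha>)) \<le> information_velocity \<epsilon> m \<xi>"
proof (rule information_velocity_geI)
  show "0 < (1 - \<epsilon>) / (1 + 2 * sqrt (\<alpha> * \<epsilon>) + \<alpha>)"
    using assms by (intro divide_pos_pos add_pos_pos) auto
  fix c assume "1 / ((1 - \<epsilon>) / (1 + 2 * sqrt (\<alpha> * \<epsilon>) + \<alpha>)) < c"
  then have "(1 + 2 * sqrt (\<alpha> * \<epsilon>) + \<alpha>) / (1 - \<epsilon>) < c" by simp
  then show "eventually (\<lambda>k. minimum_delay (m k) k \<epsilon> (\<xi> k) \<le> enat (nat \<lceil>c * real k\<rceil>)) sequentially"
    by (intro delay_achievable[OF \<epsilon> \<xi> \<open>0 < \<alpha>\<close> m])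
qed

lemma information_velocity_sublinear:
  fixes \<epsilon> :: real and \<xi> :: "nat \<Rightarrow> real"
  assumes \<epsilon>: "0 < \<epsilon>" "\<epsilon> < 1"
    and \<xi>: "\<And>k. k \<ge> 1 \<Longrightarrow> 0 < \<xi> k" "\<xi> \<longlonglongrightarrow> 0" "(\<lambda>k. 1 / real k * ln (1 / \<xi> k)) \<longlonglongrightarrow> 0"
    and m: "\<And>k. k \<ge> 1 \<Longrightarrow> m k \<ge> 1" "(\<lambda>k. real (m k)) \<in> o(\<lambda>k. real k)"
  shows "information_velocity \<epsilon> m \<xi> = ereal (1 - \<epsilon>)"
proof (rule antisym)
  show "information_velocity \<epsilon> m \<xi> \<le> ereal (1 - \<epsilon>)"
    using assms by (intro information_velocity_le)
  let ?f = "\<lambda>\<alpha>. (1 - \<epsilon>) / (1 + 2 * sqrt (\<alpha> * \<epsilon>) + \<alpha>)"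
  have "ereal (?f \<alpha>) \<le> information_velocity \<epsilon> m \<xi>" if "\<alpha> > 0" for \<alpha>
  proof (rule information_velocity_ge_linear[OF \<epsilon> \<xi>(1,3) that])
    fix \<delta> :: real assume "\<delta> > 0"
    then have "eventually (\<lambda>k. norm (real (m k)) \<le> (\<alpha> + \<delta>) * norm (real k)) sequentially"
      using that by (intro landau_o.smallD[OF m(2)]) simp
    then show "eventually (\<lambda>k. real (m k) \<le> (\<alpha> + \<delta>) * real k) sequentially" by simp
  qed
  then have "eventually (\<lambda>\<alpha>. ereal (?f \<alpha>) \<le> information_velocity \<epsilon> m \<xi>) (at_right 0)"
    by (auto simp: eventually_at_right_field intro: exI[of _ 1])
  \<comment> \<open>The linear bound is continuous at \<open>\<alpha> = 0\<close>, where it equals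
    \<open>1 - \<epsilon>\<close>.\<close>
  moreover have "((\<lambda>\<alpha>. ?f \<alpha>) \<longlongrightarrow> ?f 0) (at_right 0)"
    by (intro tendsto_intros) auto
  then have "((\<lambda>\<alpha>. ereal (?f \<alpha>)) \<longlongrightarrow> ereal (1 - \<epsilon>)) (at_right 0)"
    by simp
  ultimately show "ereal (1 - \<epsilon>) \<le> information_velocity \<epsilon> m \<xi>"
    by (intro tendsto_upperbound) auto
qed

theorem mainTheorem2:
  fixes \<epsilon> :: real and \<xi> :: "nat \<Rightarrow> real"
  assumes "0 < \<epsilon>" and "\<epsilon> < 1"
    and "\<And>k. k \<ge> 1 \<Longrightarrow> 0 < \<xi> k \<and> \<xi> k < 1"
    and "\<xi> \<longlonglongrightarrow> 0"
    and "(\<lambda>k. 1 / real k * ln (1 / \<xi> k)) \<longlonglongrightarrow> 0"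
  shows "(\<forall>m::nat. m \<ge> 1 \<longrightarrow> information_velocity \<epsilon> (\<lambda>_. m) \<xi> = ereal (1 - \<epsilon>))
    \<and> (\<forall>\<rho> m. 0 < \<rho> \<and> \<rho> < 1 \<and> poly_message_size \<rho> m \<longrightarrow>
          information_velocity \<epsilon> m \<xi> = ereal (1 - \<epsilon>))
    \<and> (\<forall>\<alpha> m. 0 < \<alpha> \<and> linear_message_size \<alpha> m \<longrightarrow>
          information_velocity \<epsilon> m \<xi> \<ge> ereal ((1 - \<epsilon>) / (1 + 2 * sqrt (\<alpha> * \<epsilon>) + \<alpha>)))"
proof (intro conjI allI impI)
  have \<xi>: "0 < \<xi> k" if "k \<ge> 1" for k using assms(3)[OF that] by simp
  \<comment> \<open>Constant sizes and, by \<open>\<rho> < 1\<close>, polynomial sizes are both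
    sublinear.\<close>
  note sublinear = information_velocity_sublinear[OF assms(1,2) \<xi> assms(4,5)]
  show "information_velocity \<epsilon> (\<lambda>_. m) \<xi> = ereal (1 - \<epsilon>)" if "m \<ge> 1" for m :: nat
  proof (rule sublinear)
    show "(\<lambda>k. real m) \<in> o(\<lambda>k. real k)" by real_asymp
  qed (use that in auto)
  show "information_velocity \<epsilon> m \<xi> = ereal (1 - \<epsilon>)"
    if "0 < \<rho> \<and> \<rho> < 1 \<and> poly_message_size \<rho> m" for \<rho> m
  proof (rule sublinear)
    have "(\<lambda>k. real (m k)) \<in> O(\<lambda>k. real k powr \<rho>)"
      using that by (auto simp: poly_message_size_def)
    also have "(\<lambda>k. real k powr \<rho>) \<in> o(\<lambda>k. real k)"
      using that by real_asymp
    finally show "(\<lambda>k. real (m k)) \<in> o(\<lambda>k. real k)" .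
  qed (use that in \<open>auto simp: poly_message_size_def\<close>)
  show "ereal ((1 - \<epsilon>) / (1 + 2 * sqrt (\<alpha> * \<epsilon>) + \<alpha>)) \<le> information_velocity \<epsilon> m \<xi>"
    if "0 < \<alpha> \<and> linear_message_size \<alpha> m" for \<alpha> m
  proof (rule information_velocity_ge_linear[OF assms(1,2) \<xi> assms(5)])
    fix \<delta> :: real assume "\<delta> > 0"
    then have "eventually (\<lambda>k. norm (real (m k) - \<alpha> * real k) \<le> \<delta> * norm (real k)) sequentially"
      using that by (intro landau_o.smallD) (auto simp: linear_message_size_def)
    then show "eventually (\<lambda>k. real (m k) \<le> (\<alpha> + \<delta>) * real k) sequentially"
      by eventually_elim (simp add: algebra_simps abs_le_iff)
  qed (use that in auto)
qed

end
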